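(* Let $\Lambda=KQ_\Lambda/I_\Lambda$ be a symmetric special multiserial algebra defined by a defining pair $(\mathcal S,\mu)$ in $Q_\Lambda$ and assume that $\mu\equiv 1$. Let $D$ be an admissible cut of $Q_\Lambda$. Denote by $A=KQ/I$ the cut algebra associated to $D$. Then the trivial extension $T(A)=A\rtimes\operatorname{Hom}_K(A,K)$ is isomorphic to $\Lambda$.
   Context: $K$ is a field; all algebras are indecomposable and finite dimensional over $K$. Quivers are finite; $ab$ denotes the arrow $a$ followed by the arrow $b$ (and is $0$ if not composable). For a presentation $KQ/I$ the ideal $I$ is admissible. An algebra is special multiserial if it is Morita equivalent to some $KQ/I$ satisfying: for every arrow $a$ there is at most one arrow $b$ with $ab\notin I$ and at most one arrow $c$ with $ca\notin I$. A cycle in a quiver is simple if it has no repeated arrows. A defining pair $(\mathcal S,\mu)$ in a quiver consists of a set $\mathcal S$ of simple cycles and a map $\mu\colon\mathcal S\to\mathbb Z_{>0}$ such that: (D0) if $C\in\mathcal S$ is a loop, then $\mu(C)>1$; (D1) if a simple cycle is in $\mathcal S$, every cyclic permutation of it is in $\mathcal S$; (D2) $\mu(C)=\mu(C')$ if $C'$ is a cyclic permutation of $C\in\mathcal S$; (D3) every arrow occurs in some cycle in $\mathcal S$; (D4) if an arrow occurs in two cycles in $\mathcal S$, these are cyclic permutations of each other. For $\mu\equiv1$ (so that $\mathcal S$ contains no loops), "$\Lambda=KQ_\Lambda/I_\Lambda$ is defined by $(\mathcal S,\mu)$" means that $I_\Lambda$ is generated by: $C-C'$ for $C,C'\in\mathcal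 S$ at the same vertex; $Ca$ for $C\in\mathcal S$ with first arrow $a$; and $ab$ for arrows $a,b$ such that $ab$ does not lie on any $C\in\mathcal S$. Call two cycles in $\mathcal S$ equivalent if one is a cyclic permutation of the other, and let $C_1,\dots,C_t$ be representatives of the equivalence classes. An admissible cut $D$ of $Q_\Lambda$ is a set of arrows of $Q_\Lambda$ consisting of exactly one arrow from each $C_i$, $i=1,\dots,t$. The cut algebra associated to $D$ is $KQ_\Lambda/\langle I_\Lambda\cup D\rangle$, where $\langle I_\Lambda\cup D\rangle$ is the ideal generated by $I_\Lambda\cup D$; it is written $KQ/I$ with $Q_0=(Q_\Lambda)_0$, $Q_1=(Q_\Lambda)_1\setminus D$ and $I=I_\Lambda\cap KQ$. $T(A)$ is the vector space $A\oplus D(A)$, $D(A)=\operatorname{Hom}_K(A,K)$, with multiplication $(a,f)(b,g)=(ab,ag+fb)$, where $(afb)(x)=f(bxa)$.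
   Formalization: The set S of simple cycles is assumed nonempty; for S empty (one vertex, no arrows) Λ = A = K while T(A) = K[x]/(x²) has dimension 2, so the claim fails there. This is the only case excluded. *)

theory Defs
  imports
    "HOL-Algebra.QuotRing"
    "HOL-Algebra.Module"
    "HOL-Library.Sublist"
    "Graph_Theory.Arc_Walk"
begin

text \<open>
  A \<open>K\<close>-algebra, for a field given as a type \<open>'k :: field\<close>, is a structure of type
  \<open>('k, 'a) module\<close>: a ring together with a scalar multiplication. (The library's locale
  \<open>algebra\<close> is not used because it is restricted to commutative algebras.)
\<close>

definition algebra_isomorphic ::
  "('k, 'a, 'm) module_scheme \<Rightarrow> ('k, 'b, 'n) module_scheme \<Rightarrow> bool"
  where "algebra_isomorphic A B \<longleftrightarrow>
    (\<exists>h \<in> ring_iso A B. \<forall>c. \<forall>x \<in> carrier A. h (c \<odot>\<^bsub>A\<^esub> x) = c \<odot>\<^bsub>B\<^esub> h x)"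

text \<open>
  An algebra is a product of two nonzero algebras iff it is the direct sum of two nonzero
  two-sided ideals.
\<close>

definition indecomposable_algebra :: "('a, 'm) ring_scheme \<Rightarrow> bool"
  where "indecomposable_algebra A \<longleftrightarrow>
    carrier A \<noteq> {\<zero>\<^bsub>A\<^esub>} \<and>
    \<not> (\<exists>I J. ideal I A \<and> ideal J A \<and> I \<noteq> {\<zero>\<^bsub>A\<^esub>} \<and> J \<noteq> {\<zero>\<^bsub>A\<^esub>} \<and>
        I \<inter> J = {\<zero>\<^bsub>A\<^esub>} \<and> I <+>\<^bsub>A\<^esub> J = carrier A)"

text \<open>The scalar multiplication on cosets follows the pattern of \<^const>\<open>rcoset_mult\<close>.\<close>

definition quotient_algebra ::
  "('k, 'a, 'm) module_scheme \<Rightarrow> 'a set \<Rightarrow> ('k, 'a set) module"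
  where "quotient_algebra A I =
    ring.extend (A Quot I) \<lparr>smult = (\<lambda>c X. \<Union>x\<in>X. I +>\<^bsub>A\<^esub> (c \<odot>\<^bsub>A\<^esub> x))\<rparr>"


section \<open>Trivial extensions\<close>

text \<open>Linear functionals are made canonical by being \<open>undefined\<close> outside the carrier.\<close>

definition dual_space :: "('k::field, 'a, 'm) module_scheme \<Rightarrow> ('a \<Rightarrow> 'k) set"
  where "dual_space A = {f \<in> extensional (carrier A).
    (\<forall>x \<in> carrier A. \<forall>y \<in> carrier A. f (x \<oplus>\<^bsub>A\<^esub> y) = f x + f y) \<and>
    (\<forall>c. \<forall>x \<in> carrier A. f (c \<odot>\<^bsub>A\<^esub> x) = c * f x)}"

definition dual_act :: "('k, 'a, 'm) module_scheme \<Rightarrow> 'a \<Rightarrow> ('a \<Rightarrow> 'k) \<Rightarrow> 'a \<Rightarrow> 'a \<Rightarrow> 'k"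
  where "dual_act A a f b = (\<lambda>x \<in> carrier A. f (b \<otimes>\<^bsub>A\<^esub> x \<otimes>\<^bsub>A\<^esub> a))"

definition dual_add ::
  "('k::field, 'a, 'm) module_scheme \<Rightarrow> ('a \<Rightarrow> 'k) \<Rightarrow> ('a \<Rightarrow> 'k) \<Rightarrow> 'a \<Rightarrow> 'k"
  where "dual_add A f g = (\<lambda>x \<in> carrier A. f x + g x)"

definition trivial_extension ::
  "('k::field, 'a, 'm) module_scheme \<Rightarrow> ('k, 'a \<times> ('a \<Rightarrow> 'k)) module"
  where "trivial_extension A =
    \<lparr>carrier = carrier A \<times> dual_space A,
     mult = (\<lambda>(a, f) (b, g).
       (a \<otimes>\<^bsub>A\<^esub> b, dual_add A (dual_act A a g \<one>\<^bsub>A\<^esub>) (dual_act A \<one>\<^bsub>A\<^esub> f b))),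
     one = (\<one>\<^bsub>A\<^esub>, \<lambda>x \<in> carrier A. 0),
     zero = (\<zero>\<^bsub>A\<^esub>, \<lambda>x \<in> carrier A. 0),
     add = (\<lambda>(a, f) (b, g). (a \<oplus>\<^bsub>A\<^esub> b, dual_add A f g)),
     smult = (\<lambda>c (a, f). (c \<odot>\<^bsub>A\<^esub> a, \<lambda>x \<in> carrier A. c * f x))\<rparr>"


section \<open>Path algebras\<close>

text \<open>
  A finite quiver is a \<^locale>\<open>fin_digraph\<close> (loops and parallel arrows are allowed). A path is
  represented by its initial vertex and its list of arrows, in the order in which they are
  traversed; \<open>(v, [])\<close> is the trivial path at \<open>v\<close>.
\<close>

definition quiver_paths :: "('v, 'e) pre_digraph \<Rightarrow> ('v \<times> 'e list) set"
  where "quiver_paths Q = {(u, p). \<exists>v. pre_digraph.awalk Q u p v}"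

text \<open>
  Elements of the path algebra are finitely supported coefficient functions on paths. The
  coefficient of a product at a path is the sum over all ways of writing that path as a
  concatenation of two paths.
\<close>

definition path_algebra ::
  "('v, 'e) pre_digraph \<Rightarrow> ('k::field, 'v \<times> 'e list \<Rightarrow> 'k) module"
  where "path_algebra Q =
    \<lparr>carrier = {f. finite {p. f p \<noteq> 0} \<and> {p. f p \<noteq> 0} \<subseteq> quiver_paths Q},
     mult = (\<lambda>f g (u, p). \<Sum>i\<le>length p.
       f (u, take i p) * g (pre_digraph.awlast Q u (take i p), drop i p)),
     one = (\<lambda>(u, p). if u \<in> verts Q \<and> p = [] then 1 else 0),
     zero = (\<lambda>_. 0),
     add = (\<lambda>f g p. f p + g p),
     smult = (\<lambda>c f p. c * f p)\<rparr>"

text \<open>The basis element given by a nonempty path.\<close>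

definition path_elem ::
  "('v, 'e) pre_digraph \<Rightarrow> 'e list \<Rightarrow> 'v \<times> 'e list \<Rightarrow> 'k::field"
  where "path_elem Q p = (\<lambda>q. if q = (tail Q (hd p), p) then 1 else 0)"


section \<open>Defining pairs and the algebras they define\<close>

definition simple_cycle :: "('v, 'e) pre_digraph \<Rightarrow> 'e list \<Rightarrow> bool"
  where "simple_cycle Q C \<longleftrightarrow>
    C \<noteq> [] \<and> pre_digraph.trail Q (tail Q (hd C)) C (tail Q (hd C))"

definition cyclic_permutation :: "'e list \<Rightarrow> 'e list \<Rightarrow> bool"
  where "cyclic_permutation C C' \<longleftrightarrow> (\<exists>n. C' = rotate n C)"

text \<open>
  The pair with \<open>S = {}\<close> on a quiver without arrows satisfies all conditions below. A single
  vertex then defines the algebra \<open>K\<close>, which is not the trivial extension of the corresponding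
  cut algebra \<open>K\<close>; hence \<open>S \<noteq> {}\<close> has to be required where this matters.
\<close>

locale defining_pair = fin_digraph Q
  for Q :: "('v, 'e) pre_digraph" +
  fixes S :: "'e list set" and \<mu> :: "'e list \<Rightarrow> nat"
  assumes simple_cycles: "C \<in> S \<Longrightarrow> simple_cycle Q C"
    and mult_pos: "C \<in> S \<Longrightarrow> \<mu> C > 0"
    and D0: "C \<in> S \<Longrightarrow> length C = 1 \<Longrightarrow> \<mu> C > 1"
    and D1: "C \<in> S \<Longrightarrow> cyclic_permutation C C' \<Longrightarrow> C' \<in> S"
    and D2: "C \<in> S \<Longrightarrow> cyclic_permutation C C' \<Longrightarrow> \<mu> C' = \<mu> C"
    and D3: "a \<in> arcs Q \<Longrightarrow> \<exists>C\<in>S. a \<in> set C"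
    and D4: "C \<in> S \<Longrightarrow> C' \<in> S \<Longrightarrow> a \<in> set C \<Longrightarrow> a \<in> set C' \<Longrightarrow> cyclic_permutation C C'"

text \<open>
  The relations for multiplicity function \<open>\<mu> \<equiv> 1\<close>. In the third set only composable arrows
  \<open>a\<close>, \<open>b\<close> are considered, since otherwise \<open>ab\<close> is zero in the path algebra already.
\<close>

definition defining_relations ::
  "('v, 'e) pre_digraph \<Rightarrow> 'e list set \<Rightarrow> ('v \<times> 'e list \<Rightarrow> 'k::field) set"
  where "defining_relations Q S =
    {path_elem Q C \<ominus>\<^bsub>path_algebra Q\<^esub> path_elem Q C' | C C'.
       C \<in> S \<and> C' \<in> S \<and> tail Q (hd C) = tail Q (hd C')} \<union>
    {path_elem Q (C @ [hd C]) | C. C \<in> S} \<union>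
    {path_elem Q [a, b] | a b.
       a \<in> arcs Q \<and> b \<in> arcs Q \<and> head Q a = tail Q b \<and> \<not> (\<exists>C\<in>S. sublist [a, b] C)}"

definition defining_ideal ::
  "('v, 'e) pre_digraph \<Rightarrow> 'e list set \<Rightarrow> ('v \<times> 'e list \<Rightarrow> 'k::field) set"
  where "defining_ideal Q S = Idl\<^bsub>path_algebra Q\<^esub> (defining_relations Q S)"

definition defined_algebra ::
  "('v, 'e) pre_digraph \<Rightarrow> 'e list set \<Rightarrow> ('k::field, ('v \<times> 'e list \<Rightarrow> 'k) set) module"
  where "defined_algebra Q S = quotient_algebra (path_algebra Q) (defining_ideal Q S)"


section \<open>Admissible cuts\<close>

text \<open>
  Cyclic permutations have the same arrows, so asking for exactly one arrow of every cycle in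
  \<open>S\<close> is the same as asking for exactly one arrow of each representative.
\<close>

definition admissible_cut :: "('v, 'e) pre_digraph \<Rightarrow> 'e list set \<Rightarrow> 'e set \<Rightarrow> bool"
  where "admissible_cut Q S D \<longleftrightarrow> D \<subseteq> arcs Q \<and> (\<forall>C\<in>S. \<exists>!a. a \<in> D \<and> a \<in> set C)"

definition cut_algebra ::
  "('v, 'e) pre_digraph \<Rightarrow> 'e list set \<Rightarrow> 'e set \<Rightarrow> ('k::field, ('v \<times> 'e list \<Rightarrow> 'k) set) module"
  where "cut_algebra Q S D = quotient_algebra (path_algebra Q)
    (Idl\<^bsub>path_algebra Q\<^esub> (defining_ideal Q S \<union> {path_elem Q [a] | a. a \<in> D}))"

end

theory Submission
  imports Defs
begin

text \<open>
  Let \<open>\<phi>\<close> be the linear form on the path algebra that sums the coefficients of the cycles in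
  \<open>S\<close>. As \<open>S\<close> is closed under rotation, \<open>\<phi>(xy) = \<phi>(yx)\<close>, and the defining ideal of \<open>\<Lambda>\<close> is exactly
  the radical of this form, because a path that extends to a cycle in \<open>S\<close> does so in an
  essentially unique way. (This fails at a vertex without arrows, which indecomposability and
  \<open>S \<noteq> {}\<close> exclude.)

  Grade the path algebra by the number of arrows in \<open>D\<close>. Every cycle in \<open>S\<close> has degree one, so
  the relations of \<open>\<Lambda>\<close> are homogeneous, \<open>\<Lambda> = \<Lambda>\<^sub>0 \<oplus> \<Lambda>\<^sub>1\<close> with \<open>\<Lambda>\<^sub>0 = A\<close>, and \<open>\<phi>\<close> pairs \<open>\<Lambda>\<^sub>0\<close> with
  \<open>\<Lambda>\<^sub>1\<close> perfectly. Hence \<open>x \<mapsto> ([x], [y] \<mapsto> \<phi>(x y\<^sub>0))\<close>, where \<open>y\<^sub>0\<close> is the degree zero part of \<open>y\<close>,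
  maps the path algebra onto \<open>T(A)\<close>, and its kernel is the defining ideal.
\<close>

section \<open>Path algebras and their quotients\<close>

text \<open>\<open>KQ\<close> is a parameter tied to \<open>path_algebra Q\<close> by an equation,
  so that it can serve as the implicit structure of the ring notation.\<close>

locale quiver_algebra = fin_digraph Q
  for Q :: "('v, 'e) pre_digraph" +
  fixes KQ :: "('k::field, 'v \<times> 'e list \<Rightarrow> 'k) module" (structure)
  assumes KQ_def: "KQ = path_algebra Q"
begin

section \<open>Ring structure of the path algebra\<close>

lemma KQ_carrier_iff:
  "f \<in> carrier KQ \<longleftrightarrow> finite {p. f p \<noteq> 0} \<and> (\<forall>p. f p \<noteq> 0 \<longrightarrow> p \<in> quiver_paths Q)"
  by (auto simp: KQ_def path_algebra_def)

lemma KQ_coeff: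
  "(f \<otimes> g) (u, p) =
    (\<Sum>i\<le>length p. f (u, take i p) * g (awlast u (take i p), drop i p))"
  "\<one> (u, p) = (if u \<in> verts Q \<and> p = [] then 1 else 0)"
  "\<zero> q = 0"
  "(f \<oplus> g) q = f q + g q"
  "(c \<odot> f) q = c * f q"
  by (simp_all add: KQ_def path_algebra_def)

lemma quiver_paths_append_iff:
  "(u, p @ q) \<in> quiver_paths Q \<longleftrightarrow>
    (u, p) \<in> quiver_paths Q \<and> (awlast u p, q) \<in> quiver_paths Q"
  by (auto simp: quiver_paths_def)

lemma quiver_paths_Cons_iff:
  "(u, a # p) \<in> quiver_paths Q \<longleftrightarrow>
    a \<in> arcs Q \<and> u = tail Q a \<and> (head Q a, p) \<in> quiver_paths Q"
  by (auto simp: quiver_paths_def awalk_Cons_iff)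

lemma quiver_paths_Nil_iff: "(u, []) \<in> quiver_paths Q \<longleftrightarrow> u \<in> verts Q"
  by (auto simp: quiver_paths_def awalk_Nil_iff)

lemma quiver_paths_start: "(u, p) \<in> quiver_paths Q \<Longrightarrow> u \<in> verts Q"
  by (auto simp: quiver_paths_def)

lemma quiver_paths_awlast: "(u, p) \<in> quiver_paths Q \<Longrightarrow> awlast u p \<in> verts Q"
  by (auto simp: quiver_paths_def)

lemma KQ_mult_closed:
  assumes f: "f \<in> carrier KQ" and g: "g \<in> carrier KQ"
  shows "f \<otimes> g \<in> carrier KQ"
proof -
  let ?s = "\<lambda>f. {q. f q \<noteq> 0}"
  have *: "\<exists>i. f (u, take i p) \<noteq> 0 \<and> g (awlast u (take i p), drop i p) \<noteq> 0"
    if "(f \<otimes> g) (u, p) \<noteq> 0" for u p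
    using that sum.neutral unfolding KQ_coeff by (metis (no_types, lifting) mult_eq_0_iff)
  \<comment> \<open>The bound also contains concatenations of pairs that do not compose; only its
    finiteness matters.\<close>
  have "?s (f \<otimes> g) \<subseteq> (\<lambda>((u, p), (v, q)). (u, p @ q)) ` (?s f \<times> ?s g)"
  proof safe
    fix u p assume "(f \<otimes> g) (u, p) \<noteq> 0"
    then obtain i where "f (u, take i p) \<noteq> 0" "g (awlast u (take i p), drop i p) \<noteq> 0"
      using * by blast
    then show "(u, p) \<in> (\<lambda>((u, p), (v, q)). (u, p @ q)) ` (?s f \<times> ?s g)"
      by (intro image_eqI[of _ _ "((u, take i p), (awlast u (take i p), drop i p))"]) auto
  qed
  moreover have "finite (?s f \<times> ?s g)"
    using f g by (simp add: KQ_carrier_iff)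
  ultimately have "finite (?s (f \<otimes> g))"
    by (meson finite_imageI finite_subset)
  moreover have "(u, p) \<in> quiver_paths Q" if "(f \<otimes> g) (u, p) \<noteq> 0" for u p
    using *[OF that] f g quiver_paths_append_iff unfolding KQ_carrier_iff
    by (metis append_take_drop_id)
  ultimately show ?thesis
    by (auto simp: KQ_carrier_iff)
qed

text \<open>Both bracketings sum over the factorisations of a path into three pieces, of lengths
  \<open>i\<close>, \<open>j\<close> and the rest. The left one is indexed by
  \<open>k = i + j\<close> and \<open>i\<close>, so a triangular sum has to be reindexed.\<close>

lemma KQ_m_assoc: "(f \<otimes> g) \<otimes> h = f \<otimes> (g \<otimes> h)"
proof (rule ext, clarify)
  fix u and p :: "'e list"
  define n where "n = length p"
  define F where "F i j = f (u, take i p) * g (awlast u (take i p), take j (drop i p)) *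
    h (awlast (awlast u (take i p)) (take j (drop i p)), drop j (drop i p))" for i j
  have "((f \<otimes> g) \<otimes> h) (u, p) = (\<Sum>k\<le>n. \<Sum>i\<le>k. F i (k - i))"
    unfolding KQ_coeff n_def sum_distrib_right
  proof (intro sum.cong refl)
    fix k assume "k \<in> {..length p}"
    then show "{..length (take k p)} = {..k}"
      by auto
    fix i assume "i \<in> {..k}"
    then have "i \<le> k" by simp
    then have t: "take k p = take i p @ take (k - i) (drop i p)"
      by (metis le_add_diff_inverse take_add)
    have "awlast u (take k p) = awlast (awlast u (take i p)) (take (k - i) (drop i p))"
      by (subst t) (rule awlast_append)
    then show "f (u, take i (take k p)) * g (awlast u (take i (take k p)), drop i (take k p)) *
        h (awlast u (take k p), drop k p) = F i (k - i)"
      using \<open>i \<le> k\<close> by (simp add: F_def min_def drop_take)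
  qed
  also have "\<dots> = (\<Sum>(i, j)\<in>{(i, j). i + j \<le> n}. F i j)"
    by (rule sum.triangle_reindex_eq[symmetric])
  also have "{(i, j). i + j \<le> n} = (SIGMA i:{..n}. {..n - i})"
    by auto
  also have "(\<Sum>(i, j)\<in>\<dots>. F i j) = (\<Sum>i\<le>n. \<Sum>j\<le>n - i. F i j)"
    by (rule sum.Sigma[symmetric]) auto
  also have "\<dots> = (f \<otimes> (g \<otimes> h)) (u, p)"
    unfolding KQ_coeff n_def sum_distrib_left
    by (intro sum.cong) (auto simp: F_def mult.assoc)
  finally show "((f \<otimes> g) \<otimes> h) (u, p) = (f \<otimes> (g \<otimes> h)) (u, p)" .
qed

lemma KQ_l_one: assumes "f \<in> carrier KQ" shows "\<one> \<otimes> f = f"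
proof (rule ext, clarify)
  fix u p
  have "(\<one> \<otimes> f) (u, p) = (\<Sum>i\<le>length p. if i = 0 then \<one> (u, []) * f (u, p) else 0)"
    unfolding KQ_coeff(1) by (intro sum.cong) (auto simp: KQ_coeff(2))
  also have "\<dots> = f (u, p)"
    using assms quiver_paths_start by (auto simp: KQ_coeff KQ_carrier_iff)
  finally show "(\<one> \<otimes> f) (u, p) = f (u, p)" .
qed

lemma KQ_r_one: assumes "f \<in> carrier KQ" shows "f \<otimes> \<one> = f"
proof (rule ext, clarify)
  fix u p
  have "(f \<otimes> \<one>) (u, p) =
      (\<Sum>i\<le>length p. if i = length p then f (u, p) * \<one> (awlast u p, []) else 0)"
    unfolding KQ_coeff(1) by (intro sum.cong) (auto simp: KQ_coeff(2))
  also have "\<dots> = f (u, p)"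
    using assms quiver_paths_awlast[of u p] by (auto simp: KQ_coeff KQ_carrier_iff)
  finally show "(f \<otimes> \<one>) (u, p) = f (u, p)" .
qed

lemma KQ_add_closed:
  assumes "f \<in> carrier KQ" "g \<in> carrier KQ" shows "f \<oplus> g \<in> carrier KQ"
proof -
  have "{p. (f \<oplus> g) p \<noteq> 0} \<subseteq> {p. f p \<noteq> 0} \<union> {p. g p \<noteq> 0}"
    by (auto simp: KQ_coeff)
  then have "finite {p. (f \<oplus> g) p \<noteq> 0}"
    using assms by (auto simp: KQ_carrier_iff intro: finite_subset)
  moreover have "q \<in> quiver_paths Q" if "(f \<oplus> g) q \<noteq> 0" for q
    using assms that unfolding KQ_carrier_iff KQ_coeff
    by (metis add.right_neutral)
  ultimately show ?thesis
    by (simp add: KQ_carrier_iff)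
qed

lemma KQ_uminus_closed: "f \<in> carrier KQ \<Longrightarrow> (\<lambda>q. - f q) \<in> carrier KQ"
  by (auto simp: KQ_carrier_iff)

lemma KQ_smult_closed: "f \<in> carrier KQ \<Longrightarrow> c \<odot> f \<in> carrier KQ"
  by (auto simp: KQ_carrier_iff KQ_coeff elim!: rev_finite_subset)

lemma KQ_ring: "ring KQ"
proof (rule ringI)
  show "abelian_group KQ"
  proof (rule abelian_groupI)
    show "\<zero> \<in> carrier KQ"
      by (auto simp: KQ_carrier_iff KQ_coeff)
    show "\<exists>g\<in>carrier KQ. g \<oplus> f = \<zero>" if "f \<in> carrier KQ" for f
      using KQ_uminus_closed[OF that] by (intro bexI) (auto simp: KQ_coeff fun_eq_iff)
  qed (auto simp: KQ_add_closed KQ_coeff fun_eq_iff)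
  have "finite ((\<lambda>u. (u, [])) ` verts Q)"
    by simp
  then have "finite {q. \<one> q \<noteq> 0}"
    by (rule rev_finite_subset) (auto simp: KQ_coeff split: if_splits)
  then have "\<one> \<in> carrier KQ"
    by (auto simp: KQ_carrier_iff KQ_coeff quiver_paths_Nil_iff split: if_splits)
  then show "Group.monoid KQ"
    by unfold_locales (auto simp: KQ_mult_closed KQ_m_assoc KQ_l_one KQ_r_one)
qed (auto simp: KQ_coeff fun_eq_iff distrib_left distrib_right sum.distrib)

sublocale KQ: ring KQ
  by (rule KQ_ring)

lemma KQ_a_inv: "f \<in> carrier KQ \<Longrightarrow> \<ominus> f = (\<lambda>q. - f q)"
  by (rule KQ.minus_equality) (auto simp: KQ_uminus_closed KQ_coeff fun_eq_iff)

lemma KQ_minus_coeff: "f \<in> carrier KQ \<Longrightarrow> g \<in> carrier KQ \<Longrightarrow> (f \<ominus> g) q = f q - g q"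
  by (simp add: a_minus_def KQ_a_inv KQ_coeff)

lemma KQ_smult_mult:
  "(c \<odot> f) \<otimes> g = c \<odot> (f \<otimes> g)"
  "f \<otimes> (c \<odot> g) = c \<odot> (f \<otimes> g)"
  by (auto simp: KQ_coeff fun_eq_iff sum_distrib_left mult_ac)

text \<open>Scalars act as multiplication by the ring element \<open>c \<odot> \<one>\<close>, so
  ring ideals are automatically subspaces.\<close>

lemma ideal_smult_closed:
  assumes "ideal I KQ" "f \<in> I" shows "c \<odot> f \<in> I"
proof -
  interpret ideal I KQ by fact
  have "c \<odot> f = (c \<odot> \<one>) \<otimes> f"
    using assms(2) by (simp add: KQ_smult_mult a_Hcarr)
  then show ?thesis
    using assms(2) by (simp add: I_l_closed KQ_smult_closed)
qed

section \<open>Paths as a basis\<close>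

definition path_basis :: "'v \<times> 'e list \<Rightarrow> 'v \<times> 'e list \<Rightarrow> 'k" where
  "path_basis q = (\<lambda>r. if r = q then 1 else 0)"

lemma path_elem_eq: "path_elem Q p = path_basis (tail Q (hd p), p)"
  by (auto simp: path_elem_def path_basis_def)

lemma path_basis_closed: "q \<in> quiver_paths Q \<Longrightarrow> path_basis q \<in> carrier KQ"
  by (auto simp: KQ_carrier_iff path_basis_def)

lemma path_basis_mult:
  "path_basis (u, p) \<otimes> path_basis (v, q) =
    (if v = awlast u p then path_basis (u, p @ q) else \<zero>)"
proof (rule ext, clarify)
  fix w r
  let ?b = "w = u \<and> r = p @ q \<and> v = awlast u p"
  \<comment> \<open>\<open>take i r = p\<close> forces \<open>i = length p\<close>, so at most one
    summand survives.\<close>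
  have "path_basis (u, p) (w, take i r) * path_basis (v, q) (awlast w (take i r), drop i r) =
      (if i = length p then if ?b then 1 else 0 else 0)" if "i \<le> length r" for i
  proof (cases "w = u \<and> take i r = p")
    case True
    from that have i: "length (take i r) = i"
      by simp
    obtain s where r: "r = take i r @ s"
      by (metis append_take_drop_id)
    with True i have "w = u" "r = p @ s" "i = length p"
      by metis+
    then show ?thesis
      by (simp add: path_basis_def)
  next
    case False
    then have "path_basis (u, p) (w, take i r) = 0" "\<not> (i = length p \<and> ?b)"
      by (auto simp: path_basis_def)
    then show ?thesis
      by auto
  qed
  then have "(path_basis (u, p) \<otimes> path_basis (v, q)) (w, r) =
      (\<Sum>i\<le>length r. if i = length p then if ?b then 1 else 0 else 0)"
    unfolding KQ_coeff by (intro sum.cong) simp_all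
  also have "\<dots> = (if ?b then 1 else 0)"
    by (simp only: sum.delta finite_atMost atMost_iff) simp
  also have "\<dots> = (if v = awlast u p then path_basis (u, p @ q) else \<zero>) (w, r)"
    by (simp add: path_basis_def KQ_coeff)
  finally show "(path_basis (u, p) \<otimes> path_basis (v, q)) (w, r) =
    (if v = awlast u p then path_basis (u, p @ q) else \<zero>) (w, r)" .
qed

text \<open>Induction over the finite support of \<open>f\<close>, restricting \<open>f\<close> to
  growing subsets. The basis case is demanded only for terms of \<open>f\<close> itself; this is
  what lets membership in an ideal be tested on the support of \<open>f\<close>.\<close>

lemma KQ_induct [consumes 1, case_names zero basis add]:
  assumes f: "f \<in> carrier KQ"
    and zero: "P \<zero>"
    and basis: "\<And>q. f q \<noteq> 0 \<Longrightarrow> q \<in> quiver_paths Q \<Longrightarrow> P (f q \<odot> path_basis q)"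
    and add: "\<And>g h. g \<in> carrier KQ \<Longrightarrow> h \<in> carrier KQ \<Longrightarrow> P g \<Longrightarrow> P h \<Longrightarrow> P (g \<oplus> h)"
  shows "P f"
proof -
  define r where "r X = (\<lambda>q. if q \<in> X then f q else 0)" for X
  have r_closed: "r X \<in> carrier KQ" for X
    using f unfolding KQ_carrier_iff r_def by (auto elim!: rev_finite_subset)
  have "P (r X)" if "finite X" for X
    using that
  proof (induction X)
    case empty
    have "r {} = \<zero>"
      by (auto simp: r_def KQ_coeff)
    then show ?case
      using zero by simp
  next
    case (insert q X)
    show ?case
    proof (cases "f q = 0")
      case True
      then have "r (insert q X) = r X"
        by (auto simp: r_def)
      then show ?thesis
        using insert by simp
    next
      case False
      then have q: "q \<in> quiver_paths Q"
        using f unfolding KQ_carrier_iff by blast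
      have "r (insert q X) = f q \<odot> path_basis q \<oplus> r X"
        using insert by (auto simp: r_def KQ_coeff path_basis_def)
      then show ?thesis
        using insert False q
        by (simp add: add basis r_closed KQ_smult_closed path_basis_closed)
    qed
  qed
  from this[of "{q. f q \<noteq> 0}"] have "P (r {q. f q \<noteq> 0})"
    using f by (simp add: KQ_carrier_iff)
  moreover have "r {q. f q \<noteq> 0} = f"
    by (auto simp: r_def)
  ultimately show ?thesis by simp
qed

lemma mem_ideal_if_paths_mem:
  assumes "f \<in> carrier KQ" "ideal I KQ"
    and "\<And>q. f q \<noteq> 0 \<Longrightarrow> q \<in> quiver_paths Q \<Longrightarrow> path_basis q \<in> I"
  shows "f \<in> I"
proof -
  interpret I: ideal I KQ by fact
  show ?thesis
    using assms(1)
  proof (induction rule: KQ_induct)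
    case (basis q)
    then show ?case
      using assms ideal_smult_closed by blast
  qed (auto simp: I.zero_closed I.a_closed)
qed

text \<open>The sum is taken coefficientwise, so that single coefficients of such combinations can
  be read off directly.\<close>

lemma ideal_sum_closed:
  assumes "ideal I KQ" "finite X" "\<And>x. x \<in> X \<Longrightarrow> F x \<in> I"
  shows "(\<lambda>q. \<Sum>x\<in>X. F x q) \<in> I"
proof -
  interpret I: ideal I KQ by fact
  show ?thesis
    using assms(2,3)
  proof (induction X)
    case empty
    have "(\<lambda>q. \<Sum>x\<in>{}. F x q) = \<zero>"
      by (simp add: KQ_coeff fun_eq_iff)
    then show ?case
      by (simp add: I.zero_closed)
  next
    case (insert x X)
    then have "(\<lambda>q. \<Sum>x\<in>insert x X. F x q) = F x \<oplus> (\<lambda>q. \<Sum>x\<in>X. F x q)"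
      by (simp add: KQ_coeff fun_eq_iff)
    then show ?case
      using insert by (simp add: I.a_closed)
  qed
qed

section \<open>Quotients of the path algebra\<close>

lemma smult_rcoset:
  assumes "ideal I KQ" "x \<in> carrier KQ"
  shows "(\<Union>y\<in>I +> x. I +> (c \<odot> y)) = I +> (c \<odot> x)"
proof -
  interpret I: ideal I KQ by fact
  \<comment> \<open>The scalar action on the quotient is a union over all representatives
    \<open>y\<close> of a coset; it collapses once they all give the same set.\<close>
  have "I +> (c \<odot> y) = I +> (c \<odot> x)" if "y \<in> I +> x" for y
  proof -
    have y: "y \<in> carrier KQ"
      using that assms(2) I.a_rcosets_carrier KQ.a_rcosetsI I.a_subset by blast
    then have "y \<ominus> x \<in> I"
      using that assms(2) KQ.ring_axioms I.a_rcos_module_minus by blast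
    then have "c \<odot> (y \<ominus> x) \<in> I"
      using assms(1) ideal_smult_closed by blast
    moreover have "c \<odot> (y \<ominus> x) = c \<odot> y \<ominus> c \<odot> x"
      using y assms(2)
      by (simp add: fun_eq_iff KQ_coeff KQ_minus_coeff KQ_smult_closed right_diff_distrib)
    ultimately show ?thesis
      using y assms KQ.quotient_eq_iff_same_a_r_cos KQ_smult_closed by metis
  qed
  then show ?thesis
    using assms(2) I.a_rcos_self by (intro SUP_eq_const) blast+
qed

lemma quotient_algebra_simps:
  fixes I
  defines "B \<equiv> quotient_algebra KQ I"
  assumes "ideal I KQ"
  shows "carrier B = (\<lambda>x. I +> x) ` carrier KQ"
    and "\<zero>\<^bsub>B\<^esub> = I"
    and "\<one>\<^bsub>B\<^esub> = I +> \<one>"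
    and "x \<in> carrier KQ \<Longrightarrow> y \<in> carrier KQ \<Longrightarrow> (I +> x) \<oplus>\<^bsub>B\<^esub> (I +> y) = I +> (x \<oplus> y)"
    and "x \<in> carrier KQ \<Longrightarrow> y \<in> carrier KQ \<Longrightarrow> (I +> x) \<otimes>\<^bsub>B\<^esub> (I +> y) = I +> (x \<otimes> y)"
    and "x \<in> carrier KQ \<Longrightarrow> c \<odot>\<^bsub>B\<^esub> (I +> x) = I +> (c \<odot> x)"
proof -
  interpret I: ideal I KQ by fact
  show "carrier B = (\<lambda>x. I +> x) ` carrier KQ"
    by (auto simp: B_def quotient_algebra_def ring.defs FactRing_simps)
  show "\<zero>\<^bsub>B\<^esub> = I" "\<one>\<^bsub>B\<^esub> = I +> \<one>"
    by (simp_all add: B_def quotient_algebra_def ring.defs FactRing_def)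
  show "(I +> x) \<oplus>\<^bsub>B\<^esub> (I +> y) = I +> (x \<oplus> y)" if "x \<in> carrier KQ" "y \<in> carrier KQ"
    using that by (simp add: B_def quotient_algebra_def ring.defs FactRing_def I.a_rcos_sum)
  show "(I +> x) \<otimes>\<^bsub>B\<^esub> (I +> y) = I +> (x \<otimes> y)" if "x \<in> carrier KQ" "y \<in> carrier KQ"
    using that
    by (simp add: B_def quotient_algebra_def ring.defs FactRing_def I.rcoset_mult_add)
  show "c \<odot>\<^bsub>B\<^esub> (I +> x) = I +> (c \<odot> x)" if "x \<in> carrier KQ"
    using that assms(2) by (simp add: B_def quotient_algebra_def ring.defs smult_rcoset)
qed

text \<open>
  The map sending \<open>H x\<close> to the coset of \<open>x\<close>; going in this direction, \<open>T\<close> need not be known to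
  be a ring.
\<close>

lemma algebra_isomorphic_quotientI:
  assumes I: "ideal I KQ"
    and onto: "H ` carrier KQ = carrier T"
    and ker: "\<And>x y. x \<in> carrier KQ \<Longrightarrow> y \<in> carrier KQ \<Longrightarrow> H x = H y \<longleftrightarrow> x \<ominus> y \<in> I"
    and mult: "\<And>x y. x \<in> carrier KQ \<Longrightarrow> y \<in> carrier KQ \<Longrightarrow> H (x \<otimes> y) = H x \<otimes>\<^bsub>T\<^esub> H y"
    and add: "\<And>x y. x \<in> carrier KQ \<Longrightarrow> y \<in> carrier KQ \<Longrightarrow> H (x \<oplus> y) = H x \<oplus>\<^bsub>T\<^esub> H y"
    and one: "H \<one> = \<one>\<^bsub>T\<^esub>"
    and smult: "\<And>c x. x \<in> carrier KQ \<Longrightarrow> H (c \<odot> x) = c \<odot>\<^bsub>T\<^esub> H x"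
  shows "algebra_isomorphic T (quotient_algebra KQ I)"
proof -
  define G where "G t = I +> (SOME x. x \<in> carrier KQ \<and> H x = t)" for t
  have G: "G (H x) = I +> x" if "x \<in> carrier KQ" for x
  proof -
    let ?y = "SOME y. y \<in> carrier KQ \<and> H y = H x"
    have "?y \<in> carrier KQ \<and> H ?y = H x"
      by (rule someI[of _ x]) (use that in simp)
    then show ?thesis
      unfolding G_def using ker that I KQ.quotient_eq_iff_same_a_r_cos by blast
  qed
  note simps = quotient_algebra_simps[OF I]
  have "G \<in> ring_iso T (quotient_algebra KQ I)"
  proof (rule ring_iso_memI)
    have "inj_on G (carrier T)"
    proof (rule inj_onI)
      fix s t assume "s \<in> carrier T" "t \<in> carrier T" "G s = G t"
      moreover then obtain x y where "s = H x" "t = H y" "x \<in> carrier KQ" "y \<in> carrier KQ"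
        using onto by blast
      ultimately show "s = t"
        using G ker I KQ.quotient_eq_iff_same_a_r_cos by metis
    qed
    moreover have "G ` carrier T = carrier (quotient_algebra KQ I)"
      unfolding simps onto[symmetric] image_image using G by (rule image_cong[OF refl])
    ultimately show "bij_betw G (carrier T) (carrier (quotient_algebra KQ I))"
      by (simp add: bij_betw_def)
    show "G t \<in> carrier (quotient_algebra KQ I)" if "t \<in> carrier T" for t
      using that G by (auto simp: simps simp flip: onto)
    fix s t assume "s \<in> carrier T" "t \<in> carrier T"
    then obtain x y where xy: "s = H x" "t = H y" "x \<in> carrier KQ" "y \<in> carrier KQ"
      using onto by blast
    then show "G (s \<otimes>\<^bsub>T\<^esub> t) = G s \<otimes>\<^bsub>quotient_algebra KQ I\<^esub> G t"
      using G[OF KQ.m_closed[of x y]] by (simp add: simps G mult)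
    show "G (s \<oplus>\<^bsub>T\<^esub> t) = G s \<oplus>\<^bsub>quotient_algebra KQ I\<^esub> G t"
      using xy G[OF KQ.a_closed[of x y]] by (simp add: simps G add)
  next
    show "G \<one>\<^bsub>T\<^esub> = \<one>\<^bsub>quotient_algebra KQ I\<^esub>"
      using G[OF KQ.one_closed] by (simp add: simps one)
  qed
  moreover have "G (c \<odot>\<^bsub>T\<^esub> t) = c \<odot>\<^bsub>quotient_algebra KQ I\<^esub> G t" if "t \<in> carrier T" for c t
    using that
    by (auto simp: simps G KQ_smult_closed smult[symmetric] simp flip: onto)
  ultimately show ?thesis
    unfolding algebra_isomorphic_def by blast
qed

text \<open>Being an ideal does not involve the scalar action, but the two records have different
  types, so the predicate is unfolded down to the ring operations they share. This makes facts about
  ideals of \<open>KQ Quot I\<close> available for the quotient algebra.\<close>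

lemma ideal_quotient_algebra_iff:
  "ideal J (quotient_algebra KQ I) \<longleftrightarrow> ideal J (KQ Quot I)"
proof -
  let ?B = "quotient_algebra KQ I" and ?C = "KQ Quot I"
  have eq: "carrier ?B = carrier ?C" "mult ?B = mult ?C" "one ?B = one ?C"
      "zero ?B = zero ?C" "add ?B = add ?C"
    by (simp_all add: quotient_algebra_def ring.defs)
  show ?thesis
    unfolding ideal_def ideal_axioms_def additive_subgroup_def ring_def ring_axioms_def
      abelian_group_def abelian_group_axioms_def abelian_monoid_def monoid_def
      comm_group_def comm_monoid_def comm_monoid_axioms_def group_def group_axioms_def
      subgroup_def m_inv_def Units_def
    by (simp add: eq)
qed

end


section \<open>The symmetric form and its radical\<close>

locale unit_defining_pair = quiver_algebra Q KQ + defining_pair Q S \<mu>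
  for Q :: "('v, 'e) pre_digraph"
    and KQ :: "('k::field, 'v \<times> 'e list \<Rightarrow> 'k) module" (structure)
    and S :: "'e list set" and \<mu> :: "'e list \<Rightarrow> nat" +
  assumes unit: "C \<in> S \<Longrightarrow> \<mu> C = 1"
    and S_nonempty: "S \<noteq> {}"
begin

section \<open>Combinatorics of the cycles in \<open>S\<close>\<close>

abbreviation start :: "'e list \<Rightarrow> 'v" where
  "start p \<equiv> tail Q (hd p)"

lemma cycle:
  assumes "C \<in> S"
  shows "C \<noteq> []" "distinct C" "(start C, C) \<in> quiver_paths Q" "awlast (start C) C = start C"
  using simple_cycles[OF assms] by (auto simp: simple_cycle_def trail_def quiver_paths_def)

lemma cycle_rotate: "p @ q \<in> S \<Longrightarrow> q @ p \<in> S"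
  using D1[of "p @ q" "q @ p"] rotate_append[of p q] unfolding cyclic_permutation_def by metis

text \<open>By \<open>D4\<close> the two cycles are rotations of each other, and as no arrow repeats
  in a simple cycle, only the trivial rotation keeps \<open>a\<close> in front.\<close>

lemma cycle_unique:
  assumes "a # p \<in> S" "a # q \<in> S"
  shows "p = q"
proof -
  let ?C = "a # p"
  obtain n where n: "a # q = rotate n ?C"
    using D4[OF assms, of a] by (auto simp: cyclic_permutation_def)
  have "hd (rotate n ?C) = ?C ! (n mod length ?C)"
    by (rule hd_rotate_conv_nth) simp
  with n have "?C ! (n mod length ?C) = ?C ! 0"
    by (metis list.sel(1) nth_Cons_0)
  moreover have "distinct ?C"
    using assms(1) by (rule cycle)
  ultimately have "n mod length ?C = 0"
    by (metis length_Cons mod_less_divisor nth_eq_iff_index_eq zero_less_Suc)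
  then show ?thesis
    using n by (metis list.inject rotate0 rotate_conv_mod id_apply)
qed

text \<open>Rotate the cycle through \<open>a\<close> given by \<open>D3\<close>. It is not a loop,
  because \<open>D0\<close> would give it multiplicity greater than one.\<close>

lemma arrow_in_cycle:
  assumes "a \<in> arcs Q"
  obtains b p where "a # b # p \<in> S"
proof -
  obtain C where C: "C \<in> S" "a \<in> set C"
    using D3[OF assms] by blast
  then obtain xs ys where "C = xs @ a # ys"
    by (meson split_list)
  with C have "a # ys @ xs \<in> S"
    using cycle_rotate by fastforce
  moreover from this have "ys @ xs \<noteq> []"
    using D0 unit by (metis One_nat_def append_Cons length_Cons less_irrefl list.size(3))
  ultimately show thesis
    using that by (metis append_Cons neq_Nil_conv)
qed

lemma finite_S: "finite S"
proof (rule finite_subset)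
  show "S \<subseteq> {C. set C \<subseteq> arcs Q \<and> distinct C}"
    using simple_cycles by (auto simp: simple_cycle_def trail_def awalk_def)
  show "finite {C. set C \<subseteq> arcs Q \<and> distinct C}"
    using finite_arcs by (rule finite_subset_distinct)
qed

section \<open>The symmetric form\<close>

definition cycle_splits :: "('e list \<times> 'e list) set" where
  "cycle_splits = {(p, q). p @ q \<in> S}"

lemma cycle_splits_eq:
  "cycle_splits = (\<lambda>(C, i). (take i C, drop i C)) ` (SIGMA C:S. {..length C})"
proof (rule subset_antisym; rule subsetI)
  fix x assume "x \<in> cycle_splits"
  then obtain p q where "x = (p, q)" "p @ q \<in> S"
    by (auto simp: cycle_splits_def)
  then show "x \<in> (\<lambda>(C, i). (take i C, drop i C)) ` (SIGMA C:S. {..length C})"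
    by (intro image_eqI[of _ _ "(p @ q, length p)"]) auto
qed (auto simp: cycle_splits_def)

lemma finite_cycle_splits: "finite cycle_splits"
  unfolding cycle_splits_eq by (intro finite_imageI finite_SigmaI finite_S) simp

text \<open>Describing this vertex as the start of the rotated cycle, and not of \<open>q\<close>,
  keeps it meaningful when \<open>q\<close> is empty.\<close>

lemma start_split:
  assumes "p @ q \<in> S"
  shows "awlast (start (p @ q)) p = start (q @ p)"
proof (cases "p = [] \<or> q = []")
  case True
  then show ?thesis
    using cycle[OF assms] by auto
next
  case False
  then have "(awlast (start (p @ q)) p, q) \<in> quiver_paths Q"
    using cycle(3)[OF assms] quiver_paths_append_iff by blast
  then show ?thesis
    using False by (cases q) (auto simp: quiver_paths_Cons_iff)
qed

definition form :: "('v \<times> 'e list \<Rightarrow> 'k) \<Rightarrow> 'k" where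
  "form f = (\<Sum>C\<in>S. f (start C, C))"

lemma form_mult:
  "form (f \<otimes> g) = (\<Sum>(p, q)\<in>cycle_splits. f (start (p @ q), p) * g (start (q @ p), q))"
proof -
  have "form (f \<otimes> g) = (\<Sum>C\<in>S. \<Sum>i\<le>length C.
      f (start C, take i C) * g (start (drop i C @ take i C), drop i C))"
    unfolding form_def KQ_coeff
  proof (intro sum.cong refl)
    fix C i assume "C \<in> S"
    then show "f (start C, take i C) * g (awlast (start C) (take i C), drop i C) =
        f (start C, take i C) * g (start (drop i C @ take i C), drop i C)"
      using start_split[of "take i C" "drop i C"] by simp
  qed
  also have "\<dots> = (\<Sum>(C, i)\<in>(SIGMA C:S. {..length C}).
      f (start C, take i C) * g (start (drop i C @ take i C), drop i C))"
    using finite_S by (intro sum.Sigma) auto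
  also have "\<dots> = (\<Sum>(p, q)\<in>cycle_splits. f (start (p @ q), p) * g (start (q @ p), q))"
    by (rule sum.reindex_bij_witness[of _ "\<lambda>(p, q). (p @ q, length p)"
          "\<lambda>(C, i). (take i C, drop i C)"]) (auto simp: cycle_splits_def)
  finally show ?thesis .
qed

text \<open>Swapping the two pieces of a split rotates the cycle, hence permutes the splits.\<close>

lemma form_commute: "form (f \<otimes> g) = form (g \<otimes> f)"
  unfolding form_mult
  by (rule sum.reindex_bij_witness[of _ prod.swap prod.swap])
    (auto simp: cycle_splits_def cycle_rotate mult.commute)

lemma form_linear:
  "form \<zero> = 0" "form (f \<oplus> g) = form f + form g" "form (c \<odot> f) = c * form f"
  by (simp_all add: form_def KQ_coeff sum.distrib sum_distrib_left)

lemma form_minus: "f \<in> carrier KQ \<Longrightarrow> g \<in> carrier KQ \<Longrightarrow> form (f \<ominus> g) = form f - form g"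
  by (simp add: form_def KQ_minus_coeff sum_subtractf)

text \<open>The first arrow of \<open>p\<close> determines the cycle, so a nonempty \<open>p\<close>
  has \<open>q\<close> as its only complement, and pairing with \<open>p\<close> reads off a single
  coefficient.\<close>

lemma form_path_basis_mult:
  assumes pq: "p @ q \<in> S" and p: "p \<noteq> []"
  shows "form (path_basis (start (p @ q), p) \<otimes> f) = f (start (q @ p), q)"
proof -
  have eq: "q' = q" if "p @ q' \<in> S" for q'
  proof -
    obtain a p' where "p = a # p'"
      using p by (meson neq_Nil_conv)
    then show ?thesis
      using that pq cycle_unique by (metis append_Cons same_append_eq)
  qed
  have "form (path_basis (start (p @ q), p) \<otimes> f) =
      (\<Sum>x\<in>cycle_splits. if x = (p, q) then f (start (q @ p), q) else 0)"
    unfolding form_mult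
  proof (intro sum.cong refl, clarify)
    fix p' q' assume "(p', q') \<in> cycle_splits"
    then have "p' = p \<Longrightarrow> q' = q"
      using eq by (simp add: cycle_splits_def)
    then show "path_basis (start (p @ q), p) (start (p' @ q'), p') * f (start (q' @ p'), q') =
        (if (p', q') = (p, q) then f (start (q @ p), q) else 0)"
      by (cases "p' = p") (auto simp: path_basis_def)
  qed
  also have "\<dots> = f (start (q @ p), q)"
    using finite_cycle_splits pq by (simp add: cycle_splits_def)
  finally show ?thesis .
qed

lemma trivial_path_mult:
  "(path_basis (u, []) \<otimes> f) (w, r) = (if w = u then f (u, r) else 0)"
proof -
  have "(path_basis (u, []) \<otimes> f) (w, r) =
      (\<Sum>i\<le>length r. if i = 0 then (if w = u then f (u, r) else 0) else 0)"
    unfolding KQ_coeff by (intro sum.cong) (auto simp: path_basis_def)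
  then show ?thesis
    by simp
qed

text \<open>The complements of a trivial path are all the cycles at its vertex, so here a sum of
  coefficients replaces the single one.\<close>

lemma form_trivial_path_mult:
  "form (path_basis (u, []) \<otimes> f) = (\<Sum>C\<in>S. if start C = u then f (u, C) else 0)"
  by (simp add: form_def trivial_path_mult)

text \<open>As \<open>S\<close> is closed under rotation, a path that is not a prefix of a cycle in
  \<open>S\<close> is not a segment of one either; excluding prefixes therefore suffices.\<close>

lemma form_dead_path_mult:
  assumes "\<And>q. p @ q \<notin> S"
  shows "form (path_basis (u, p) \<otimes> f) = 0"
  unfolding form_mult
  by (rule sum.neutral) (use assms in \<open>auto simp: cycle_splits_def path_basis_def\<close>)

section \<open>The radical and the defining relations\<close>

definition form_radical :: "('v \<times> 'e list \<Rightarrow> 'k) set" where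
  "form_radical = {f \<in> carrier KQ. \<forall>g\<in>carrier KQ. form (f \<otimes> g) = 0}"

text \<open>Associativity gives closure under right multiplication; the symmetry of the form carries
  a left factor round to the right.\<close>

lemma form_radical_ideal: "ideal form_radical KQ"
proof (rule idealI[OF KQ_ring])
  show "subgroup form_radical (add_monoid KQ)"
  proof (rule KQ.add.subgroupI)
    show "form_radical \<noteq> {}"
      unfolding form_radical_def using form_linear(1) by (auto intro!: exI[of _ \<zero>])
    show "\<ominus> f \<in> form_radical" if "f \<in> form_radical" for f
    proof -
      have "form ((\<ominus> f) \<otimes> g) = 0" if "g \<in> carrier KQ" for g
      proof -
        have "(\<ominus> f) \<otimes> g = (- 1) \<odot> (f \<otimes> g)"
          using \<open>f \<in> form_radical\<close>
          by (simp add: form_radical_def KQ_a_inv KQ_coeff fun_eq_iff sum_negf)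
        then show ?thesis
          using \<open>f \<in> form_radical\<close> that by (simp add: form_radical_def form_linear)
      qed
      then show ?thesis
        using that by (simp add: form_radical_def)
    qed
  qed (auto simp: form_radical_def KQ.l_distr form_linear)
  fix f x assume f: "f \<in> form_radical" and x: "x \<in> carrier KQ"
  then show "f \<otimes> x \<in> form_radical"
    by (auto simp: form_radical_def KQ_m_assoc)
  have "form ((x \<otimes> f) \<otimes> g) = form (f \<otimes> (g \<otimes> x))" for g
    using form_commute[of x "f \<otimes> g"] by (simp add: KQ_m_assoc)
  then show "x \<otimes> f \<in> form_radical"
    using f x by (simp add: form_radical_def)
qed

lemma dead_path_in_form_radical:
  assumes "(u, p) \<in> quiver_paths Q" "\<And>q. p @ q \<notin> S"
  shows "path_basis (u, p) \<in> form_radical"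
  using assms by (simp add: form_radical_def path_basis_closed form_dead_path_mult)

abbreviation relations :: "('v \<times> 'e list \<Rightarrow> 'k) set" where
  "relations \<equiv> defining_relations Q S"

abbreviation relation_ideal :: "('v \<times> 'e list \<Rightarrow> 'k) set" where
  "relation_ideal \<equiv> defining_ideal Q S"

text \<open>A cycle paired with \<open>g\<close> sees only the coefficient of \<open>g\<close> at
  the trivial path of its vertex, so cycles at the same vertex cannot be told apart. The other two
  kinds of relations are paths contained in no cycle of \<open>S\<close>.\<close>

lemma defining_relations_in_form_radical: "relations \<subseteq> form_radical"
proof -
  interpret R: ideal form_radical KQ
    by (rule form_radical_ideal)
  have 1: "path_basis (u, C) \<ominus> path_basis (u, C') \<in> form_radical"
    if C: "C \<in> S" "C' \<in> S" "start C = u" "start C' = u" for C C' u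
  proof -
    have B: "path_basis (u, C) \<in> carrier KQ" "form (path_basis (u, C) \<otimes> g) = g (u, [])"
      if "C \<in> S" "start C = u" for C g
      using that cycle form_path_basis_mult[of C "[]"] path_basis_closed by auto
    note BC = B(1)[OF C(1,3)] B(1)[OF C(2,4)] B(2)[OF C(1,3)] B(2)[OF C(2,4)]
    have "form ((path_basis (u, C) \<ominus> path_basis (u, C')) \<otimes> g) = 0" if g: "g \<in> carrier KQ" for g
    proof -
      have "(path_basis (u, C) \<ominus> path_basis (u, C')) \<otimes> g =
          path_basis (u, C) \<otimes> g \<ominus> path_basis (u, C') \<otimes> g"
        using BC(1,2) g by (simp add: a_minus_def KQ.l_distr KQ.l_minus)
      then show ?thesis
        using BC g by (simp add: form_minus)
    qed
    then show ?thesis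
      unfolding form_radical_def using BC(1,2) KQ.minus_closed by blast
  qed
  have 2: "path_basis (start C, C @ [hd C]) \<in> form_radical" if "C \<in> S" for C
  proof (rule dead_path_in_form_radical)
    show "(start C, C @ [hd C]) \<in> quiver_paths Q"
    proof -
      have "hd C \<in> arcs Q"
        using cycle(1,3)[OF that] by (cases C) (simp_all add: quiver_paths_Cons_iff)
      then show ?thesis
        using wellformed cycle(3,4)[OF that]
        by (simp add: quiver_paths_append_iff quiver_paths_Cons_iff quiver_paths_Nil_iff)
    qed
    \<comment> \<open>The path repeats its first arrow, which a simple cycle never does.\<close>
    show "(C @ [hd C]) @ q \<notin> S" for q
      using cycle(1)[OF that] cycle(2)[of "(C @ [hd C]) @ q"] by auto
  qed
  have 3: "path_basis (tail Q a, [a, b]) \<in> form_radical"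
    if "a \<in> arcs Q" "b \<in> arcs Q" "head Q a = tail Q b" "\<not> (\<exists>C\<in>S. sublist [a, b] C)" for a b
  proof (rule dead_path_in_form_radical)
    show "(tail Q a, [a, b]) \<in> quiver_paths Q"
      using that by (simp add: quiver_paths_Cons_iff quiver_paths_Nil_iff)
    show "[a, b] @ q \<notin> S" for q
      using that(4) by (metis append_Nil sublist_appendI)
  qed
  show ?thesis
    unfolding defining_relations_def KQ_def[symmetric] path_elem_eq
    using 1 2 3 cycle(1) by (auto simp: hd_append2)
qed

lemma defining_relations_closed: "relations \<subseteq> carrier KQ"
  using defining_relations_in_form_radical by (auto simp: form_radical_def)

lemma defining_ideal_is_ideal: "ideal relation_ideal KQ"
  unfolding defining_ideal_def KQ_def[symmetric]
  by (rule KQ.genideal_ideal) (rule defining_relations_closed)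

lemma defining_relations_in_ideal: "relations \<subseteq> relation_ideal"
  unfolding defining_ideal_def KQ_def[symmetric]
  by (rule KQ.genideal_self) (rule defining_relations_closed)

text \<open>Remove the last arrow \<open>b\<close>. If the rest \<open>p\<close> is still dead,
  multiply by \<open>b\<close>. Otherwise \<open>p\<close> runs along a cycle which \<open>b\<close>
  either leaves, giving a relation of length two, or continues beyond one full turn, giving a
  relation \<open>C @ [hd C]\<close>.\<close>

lemma dead_path_in_defining_ideal:
  assumes "(u, p) \<in> quiver_paths Q" "p \<noteq> []" "\<And>q. p @ q \<notin> S"
  shows "path_basis (u, p) \<in> relation_ideal"
  using assms
proof (induction p rule: rev_induct)
  case (snoc b p)
  interpret I: ideal "relation_ideal" KQ
    by (rule defining_ideal_is_ideal)
  have p: "(u, p) \<in> quiver_paths Q" and b: "b \<in> arcs Q" "awlast u p = tail Q b"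
    using snoc.prems(1) by (auto simp: quiver_paths_append_iff quiver_paths_Cons_iff)
  show ?case
  proof (cases "\<exists>q. p @ q \<in> S")
    case False
    then have "p \<noteq> []"
      using S_nonempty by auto
    then have "path_basis (u, p) \<in> relation_ideal"
      using False p snoc.IH by blast
    moreover have "path_basis (tail Q b, [b]) \<in> carrier KQ"
      using b wellformed by (intro path_basis_closed)
        (simp add: quiver_paths_Cons_iff quiver_paths_Nil_iff)
    moreover have "path_basis (u, p @ [b]) = path_basis (u, p) \<otimes> path_basis (tail Q b, [b])"
      using b by (simp add: path_basis_mult)
    ultimately show ?thesis
      by (simp add: I.I_r_closed)
  next
    case True
    then obtain q where q: "p @ q \<in> S" by blast
    have "p \<noteq> []"
      using arrow_in_cycle[OF b(1)] snoc.prems(3) by (metis append_Cons append_Nil)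
    show ?thesis
    proof (cases "q = [] \<and> b = hd p")
      case True
      moreover have "u = start p"
        using p \<open>p \<noteq> []\<close> by (cases p) (auto simp: quiver_paths_Cons_iff)
      ultimately have "path_basis (u, p @ [b]) = path_elem Q (p @ [hd p])" "p \<in> S"
        using \<open>p \<noteq> []\<close> q by (simp_all add: path_elem_eq hd_append2)
      then have "path_basis (u, p @ [b]) \<in> relations"
        unfolding defining_relations_def by blast
      then show ?thesis
        using defining_relations_in_ideal by blast
    next
      case False
      obtain p' a where p': "p = p' @ [a]"
        using \<open>p \<noteq> []\<close> by (meson rev_exhaust)
      have rot: "a # q @ p' \<in> S"
        using q cycle_rotate[of p' "a # q"] by (simp add: p')
      have a: "a \<in> arcs Q" "awlast u p' = tail Q a" "(u, p') \<in> quiver_paths Q"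
        using p by (auto simp: p' quiver_paths_append_iff quiver_paths_Cons_iff)
      have ab: "head Q a = tail Q b"
        using b by (simp add: p' awlast_append)
      \<comment> \<open>The arrow that follows \<open>a\<close> on a cycle is unique: it is the
        first arrow of \<open>q\<close> or, if \<open>q\<close> is empty, of \<open>p\<close>. In
        the first case \<open>p @ [b]\<close> would extend to a cycle; the second has been treated
        above.\<close>
      have "\<not> sublist [a, b] C" if "C \<in> S" for C
      proof
        assume "sublist [a, b] C"
        then obtain xs ys where "C = xs @ [a, b] @ ys"
          by (auto simp: sublist_def)
        then have "a # b # ys @ xs \<in> S"
          using that cycle_rotate[of xs "[a, b] @ ys"] by simp
        then have *: "q @ p' = b # ys @ xs"
          using rot cycle_unique by blast
        show False
        proof (cases q)
          case Nil
          then have "b = hd p"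
            using * by (simp add: p')
          then show False
            using \<open>\<not> (q = [] \<and> b = hd p)\<close> Nil by simp
        next
          case (Cons c q')
          then have "(p @ [b]) @ q' \<in> S"
            using * q by simp
          then show False
            using snoc.prems(3) by blast
        qed
      qed
      then have "path_elem Q [a, b] \<in> relations"
        unfolding defining_relations_def using a b ab by blast
      then have "path_basis (tail Q a, [a, b]) \<in> relation_ideal"
        using defining_relations_in_ideal by (auto simp: path_elem_eq)
      moreover have "path_basis (u, p @ [b]) = path_basis (u, p') \<otimes> path_basis (tail Q a, [a, b])"
        using a by (simp add: p' path_basis_mult)
      ultimately show ?thesis
        using a by (simp add: I.I_l_closed path_basis_closed)
    qed
  qed
qed simp

section \<open>Excluding vertices without arrows\<close>

definition trivial_kernel :: "'v \<Rightarrow> ('v \<times> 'e list \<Rightarrow> 'k) set" where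
  "trivial_kernel v = {f \<in> carrier KQ. f (v, []) = 0}"

text \<open>A trivial path factors only into trivial paths, so taking its coefficient is
  multiplicative.\<close>

lemma trivial_kernel_ideal: "ideal (trivial_kernel v) KQ"
proof (rule idealI[OF KQ_ring])
  show "subgroup (trivial_kernel v) (add_monoid KQ)"
    by (rule KQ.add.subgroupI)
      (auto simp: trivial_kernel_def KQ_coeff KQ_a_inv KQ_uminus_closed intro!: exI[of _ \<zero>])
qed (auto simp: trivial_kernel_def KQ_coeff)

text \<open>All generators are combinations of paths of positive length. Consequently trivial paths
  stay nonzero in the quotient.\<close>

lemma relation_ideal_trivial_kernel: "relation_ideal \<subseteq> trivial_kernel v"
  unfolding defining_ideal_def KQ_def[symmetric]
proof (rule KQ.genideal_minimal[OF trivial_kernel_ideal], rule subsetI)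
  fix f assume f: "f \<in> relations"
  then have "f \<in> carrier KQ"
    using defining_relations_closed by blast
  moreover have "f (v, []) = 0"
  proof -
    have "path_elem Q C \<in> carrier KQ" if "C \<in> S" for C
      using cycle(3)[OF that] by (simp add: path_elem_eq path_basis_closed)
    moreover have "path_elem Q C (v, []) = (0 :: 'k)" if "C \<noteq> []" for C
      using that by (simp add: path_elem_eq path_basis_def)
    ultimately show ?thesis
      using f cycle(1) unfolding defining_relations_def KQ_def[symmetric]
      by (auto simp: KQ_minus_coeff)
  qed
  ultimately show "f \<in> trivial_kernel v"
    by (simp add: trivial_kernel_def)
qed

text \<open>If no cycle starts at \<open>v\<close>, then no arrow starts or ends there, since every
  arrow lies on a cycle. The multiples of the trivial path at \<open>v\<close> then form an ideal
  \<open>N\<close>, and the quotient is the direct sum of the images of \<open>N\<close> and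
  \<open>trivial_kernel v\<close>. The latter is nonzero because a cycle in \<open>S\<close>
  supplies another vertex.\<close>

lemma not_isolated:
  assumes indec: "indecomposable_algebra (quotient_algebra KQ relation_ideal)"
    and v: "v \<in> verts Q"
  shows "\<exists>C\<in>S. start C = v"
proof (rule ccontr)
  let ?I = relation_ideal
  let ?B = "quotient_algebra KQ ?I"
  note I = defining_ideal_is_ideal
  interpret I: ideal ?I KQ
    by (rule I)
  note simps = quotient_algebra_simps[OF I]
  assume "\<not> (\<exists>C\<in>S. start C = v)"
  then have no_start: "start C \<noteq> v" if "C \<in> S" for C
    using that by blast
  have tl: "tail Q a \<noteq> v" if "a \<in> arcs Q" for a
    using arrow_in_cycle[OF that] no_start by (metis list.sel(1))
  have hd: "head Q a \<noteq> v" if a: "a \<in> arcs Q" for a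
  proof -
    obtain b p where *: "a # b # p \<in> S"
      using arrow_in_cycle[OF a] by blast
    then have "head Q a = tail Q b"
      using cycle(3)[OF *] by (simp add: quiver_paths_Cons_iff)
    moreover have "b \<in> arcs Q"
      using cycle(3)[OF *] by (simp add: quiver_paths_Cons_iff)
    ultimately show ?thesis
      using tl by simp
  qed
  have from_v: "p = []" if "(v, p) \<in> quiver_paths Q" for p
    using that tl by (cases p) (auto simp: quiver_paths_Cons_iff)
  have to_v: "p = []" if "(u, p) \<in> quiver_paths Q" "awlast u p = v" for u p
    using that hd
    by (cases p rule: rev_cases)
      (auto simp: quiver_paths_append_iff quiver_paths_Cons_iff awlast_append)
  define N where "N = {f \<in> carrier KQ. \<forall>q. q \<noteq> (v, []) \<longrightarrow> f q = 0}"
  have N: "ideal N KQ"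
  proof (rule idealI[OF KQ_ring])
    show "subgroup N (add_monoid KQ)"
      by (rule KQ.add.subgroupI) (auto simp: N_def KQ_coeff KQ_a_inv KQ_uminus_closed intro!: exI[of _ \<zero>])
    fix f x assume f: "f \<in> N" and x: "x \<in> carrier KQ"
    have path: "q \<in> quiver_paths Q" if "x q \<noteq> 0" for q
      using x that unfolding KQ_carrier_iff by blast
    have f0: "q = (v, [])" if "f q \<noteq> 0" for q
      using f that unfolding N_def by blast
    have "(f \<otimes> x) q = 0" if q: "q \<noteq> (v, [])" for q
    proof (cases q)
      case (Pair u p)
      have "f (u, take i p) * x (awlast u (take i p), drop i p) = 0" for i
      proof (rule ccontr)
        assume *: "f (u, take i p) * x (awlast u (take i p), drop i p) \<noteq> 0"
        then have 1: "u = v" "take i p = []"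
          using f0[of "(u, take i p)"] by auto
        then have "awlast u (take i p) = v"
          unfolding 1(2) by simp
        then have "drop i p = []"
          using * path[of "(v, drop i p)"] from_v by (metis mult_eq_0_iff)
        then show False
          using 1 q Pair append_take_drop_id[of i p] by (metis append_Nil)
      qed
      then show ?thesis
        unfolding Pair KQ_coeff by (intro sum.neutral) blast
    qed
    then show "f \<otimes> x \<in> N"
      using f x by (simp add: N_def)
    have "(x \<otimes> f) q = 0" if q: "q \<noteq> (v, [])" for q
    proof (cases q)
      case (Pair u p)
      have "x (u, take i p) * f (awlast u (take i p), drop i p) = 0" for i
      proof (rule ccontr)
        assume *: "x (u, take i p) * f (awlast u (take i p), drop i p) \<noteq> 0"
        then have 1: "awlast u (take i p) = v" "drop i p = []"
          using f0[of "(awlast u (take i p), drop i p)"] by auto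
        moreover have "take i p = []"
        proof (rule to_v)
          show "(u, take i p) \<in> quiver_paths Q"
            using * by (intro path) auto
        qed (rule 1(1))
        ultimately show False
          using q Pair append_take_drop_id[of i p] by simp
      qed
      then show ?thesis
        unfolding Pair KQ_coeff by (intro sum.neutral) blast
    qed
    then show "x \<otimes> f \<in> N"
      using f x by (simp add: N_def)
  qed
  have e: "path_basis (w, []) \<in> carrier KQ" "path_basis (w, []) \<notin> ?I" if "w \<in> verts Q" for w
  proof -
    show "path_basis (w, []) \<in> carrier KQ"
      using that by (simp add: path_basis_closed quiver_paths_Nil_iff)
    have "path_basis (w, []) \<notin> trivial_kernel w"
      by (simp add: trivial_kernel_def path_basis_def)
    then show "path_basis (w, []) \<notin> ?I"
      using relation_ideal_trivial_kernel by blast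
  qed
  let ?M = "trivial_kernel v"
  let ?X = "(\<lambda>f. ?I +> f) ` ?M" and ?Y = "(\<lambda>f. ?I +> f) ` N"
  have ideals: "ideal ?X ?B" "ideal ?Y ?B"
    unfolding ideal_quotient_algebra_iff
    by (rule KQ.ring_ideal_imp_quot_ideal[OF I] trivial_kernel_ideal N)+
  have coset_zero: "?I +> f = ?I \<longleftrightarrow> f \<in> ?I" if "f \<in> carrier KQ" for f
    using that KQ.a_coset_join1 KQ.a_coset_join2 I.a_subgroup by blast
  have "?X \<noteq> {?I}"
  proof -
    obtain C where C: "C \<in> S"
      using S_nonempty by blast
    define w where "w = start C"
    have w: "w \<in> verts Q" "w \<noteq> v"
      using cycle(3)[OF C] no_start[OF C] quiver_paths_start by (auto simp: w_def)
    then have "path_basis (w, []) \<in> ?M"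
      using e by (simp add: trivial_kernel_def path_basis_def)
    then show ?thesis
      using e[OF w(1)] coset_zero by blast
  qed
  moreover have "?Y \<noteq> {?I}"
  proof -
    have "path_basis (v, []) \<in> N"
      using e[OF v] by (simp add: N_def path_basis_def)
    then show ?thesis
      using e[OF v] coset_zero by blast
  qed
  moreover have "?X \<inter> ?Y = {?I}"
  proof
    show "?X \<inter> ?Y \<subseteq> {?I}"
    proof
      fix Z assume "Z \<in> ?X \<inter> ?Y"
      then obtain f g where fg: "Z = ?I +> f" "Z = ?I +> g" "f \<in> ?M" "g \<in> N"
        by blast
      then have c: "f \<in> carrier KQ" "g \<in> carrier KQ"
        by (auto simp: trivial_kernel_def N_def)
      then have "f \<ominus> g \<in> ?I"
        using fg I KQ.quotient_eq_iff_same_a_r_cos by metis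
      \<comment> \<open>Elements of the defining ideal have no terms at trivial paths, so
        \<open>f\<close> and \<open>g\<close> agree at \<open>(v, [])\<close>, the only place where
        \<open>g\<close> could be nonzero.\<close>
      then have "f \<ominus> g \<in> ?M"
        using relation_ideal_trivial_kernel by blast
      then have "g (v, []) = 0"
        using fg(3) c by (simp add: trivial_kernel_def KQ_minus_coeff)
      then have "g q = 0" for q
      proof -
        have "q \<noteq> (v, []) \<Longrightarrow> g q = 0"
          using fg(4) unfolding N_def by blast
        then show ?thesis
          using \<open>g (v, []) = 0\<close> by (cases "q = (v, [])") simp_all
      qed
      then have "g = \<zero>"
        by (simp add: fun_eq_iff KQ_coeff)
      then show "Z \<in> {?I}"
        using fg(2) coset_zero I.zero_closed by simp
    qed
    have "\<zero> \<in> ?M" "\<zero> \<in> N"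
      by (simp_all add: trivial_kernel_def N_def KQ_coeff)
    moreover have "?I +> \<zero> = ?I"
      using coset_zero I.zero_closed by simp
    ultimately show "{?I} \<subseteq> ?X \<inter> ?Y"
      by (metis IntI empty_subsetI image_eqI insert_subset)
  qed
  moreover have "?X <+>\<^bsub>?B\<^esub> ?Y = carrier ?B"
  proof
    have "f \<oplus> g \<in> carrier KQ" if "f \<in> ?M" "g \<in> N" for f g
      using that by (simp add: trivial_kernel_def N_def)
    then show "?X <+>\<^bsub>?B\<^esub> ?Y \<subseteq> carrier ?B"
      by (auto simp: set_add_def' simps trivial_kernel_def N_def)
    show "carrier ?B \<subseteq> ?X <+>\<^bsub>?B\<^esub> ?Y"
    proof
      fix Z assume "Z \<in> carrier ?B"
      then obtain f where f: "f \<in> carrier KQ" "Z = ?I +> f"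
        by (auto simp: simps)
      define g where "g = f (v, []) \<odot> path_basis (v, [])"
      have g: "g \<in> carrier KQ"
        using e[OF v] by (simp add: g_def KQ_smult_closed)
      then have "g \<in> N"
        by (simp add: N_def g_def KQ_coeff path_basis_def)
      moreover have "f \<ominus> g \<in> ?M"
        using f g by (simp add: trivial_kernel_def KQ_minus_coeff)
          (simp add: g_def KQ_coeff path_basis_def)
      moreover have "Z = (?I +> (f \<ominus> g)) \<oplus>\<^bsub>?B\<^esub> (?I +> g)"
      proof -
        have "f \<ominus> g \<oplus> g = f"
          using f g by (simp add: fun_eq_iff KQ_coeff KQ_minus_coeff)
        then show ?thesis
          using f g by (simp add: simps)
      qed
      ultimately show "Z \<in> ?X <+>\<^bsub>?B\<^esub> ?Y"
        unfolding set_add_def' by blast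
    qed
  qed
  ultimately show False
    using indec ideals unfolding indecomposable_algebra_def by (metis simps(2))
qed

text \<open>For the inclusion of the radical, subtract from \<open>f\<close> a combination
  \<open>k\<close> of differences of cycles that agrees with \<open>f\<close> on all cycles. The
  coefficient at any other path with a complement is detected by a pairing and vanishes, so
  \<open>f \<ominus> k\<close> is supported on dead paths.\<close>

lemma relation_ideal_eq_form_radical:
  assumes not_isolated: "\<And>v. v \<in> verts Q \<Longrightarrow> \<exists>C\<in>S. start C = v"
  shows "relation_ideal = form_radical"
proof
  interpret I: ideal relation_ideal KQ
    by (rule defining_ideal_is_ideal)
  show "relation_ideal \<subseteq> form_radical"
    unfolding defining_ideal_def KQ_def[symmetric]
    by (rule KQ.genideal_minimal[OF form_radical_ideal defining_relations_in_form_radical])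
  show "form_radical \<subseteq> relation_ideal"
  proof
    fix f assume f: "f \<in> form_radical"
    then have fc: "f \<in> carrier KQ"
      by (simp add: form_radical_def)
    have rad: "form (g \<otimes> f) = 0" if "g \<in> carrier KQ" for g
      using f that form_commute[of g f] by (simp add: form_radical_def)
    \<comment> \<open>One reference cycle per vertex; modulo the relations every cycle at the vertex
      equals it.\<close>
    define c where "c v = (SOME C. C \<in> S \<and> start C = v)" for v
    have c: "c v \<in> S" "start (c v) = v" if "v \<in> verts Q" for v
      using someI_ex[of "\<lambda>C. C \<in> S \<and> start C = v"] not_isolated[OF that]
      by (auto simp: c_def)
    have vS: "start C \<in> verts Q" if "C \<in> S" for C
      using cycle(3)[OF that] by (rule quiver_paths_start)
    define b where "b C = path_basis (start C, C) \<ominus> path_basis (start C, c (start C))" for C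
    have b_coeff: "b C q = path_basis (start C, C) q - path_basis (start C, c (start C)) q"
      if "C \<in> S" for C q
      using that c[OF vS[OF that]] cycle(3)[of "c (start C)"] cycle(3)[OF that]
      by (simp add: b_def KQ_minus_coeff path_basis_closed)
    have "b C \<in> relations" if "C \<in> S" for C
      using that c[OF vS[OF that]]
      unfolding defining_relations_def KQ_def[symmetric] b_def path_elem_eq by fastforce
    then have "b C \<in> relation_ideal" if "C \<in> S" for C
      using that defining_relations_in_ideal by blast
    then have bI: "f (start C, C) \<odot> b C \<in> relation_ideal" if "C \<in> S" for C
      using that defining_ideal_is_ideal ideal_smult_closed by blast
    define k where "k = (\<lambda>q. \<Sum>C\<in>S. (f (start C, C) \<odot> b C) q)"
    have kI: "k \<in> relation_ideal"
      unfolding k_def by (rule ideal_sum_closed[OF defining_ideal_is_ideal finite_S bI])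
    have k_coeff: "k (u, p) = (\<Sum>C\<in>S. if C = p \<and> start C = u then f (u, p) else 0) -
        (\<Sum>C\<in>S. if start C = u \<and> p = c u then f (u, C) else 0)" for u p
      unfolding k_def sum_subtractf[symmetric] KQ_coeff
      by (intro sum.cong) (auto simp: b_coeff path_basis_def)
    have k_other: "k (u, p) = 0" if "p \<notin> S \<or> start p \<noteq> u" "u \<in> verts Q" for u p
    proof -
      have "(\<Sum>C\<in>S. if C = p \<and> start C = u then f (u, p) else 0) = 0"
        by (rule sum.neutral) (use that(1) in auto)
      moreover have "(\<Sum>C\<in>S. if start C = u \<and> p = c u then f (u, C) else 0) = 0"
        by (rule sum.neutral) (use that c in auto)
      ultimately show ?thesis
        unfolding k_coeff by simp
    qed
    have k_cycle: "k (start C, C) = f (start C, C)" if C: "C \<in> S" for C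
    proof -
      \<comment> \<open>Pairing \<open>f\<close> with the trivial path shows that its coefficients
        at the cycles of one vertex add up to zero. So \<open>k\<close> has the right value also at
        the reference cycle, where this sum is subtracted.\<close>
      have "(\<Sum>C'\<in>S. if start C' = start C then f (start C, C') else 0) = 0"
        using rad[of "path_basis (start C, [])"] vS[OF C]
        by (simp add: form_trivial_path_mult path_basis_closed quiver_paths_Nil_iff)
      then have "(\<Sum>C'\<in>S. if start C' = start C \<and> C = c (start C) then f (start C, C') else 0) = 0"
        by (cases "C = c (start C)") simp_all
      moreover have "(\<Sum>C'\<in>S. if C' = C \<and> start C' = start C then f (start C, C) else 0) =
          (\<Sum>C'\<in>S. if C' = C then f (start C, C) else 0)"
        by (intro sum.cong) auto
      ultimately show ?thesis
        unfolding k_coeff using finite_S C by simp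
    qed
    have "f \<ominus> k \<in> relation_ideal"
    proof (rule mem_ideal_if_paths_mem[OF _ defining_ideal_is_ideal])
      have kc: "k \<in> carrier KQ"
        using kI by (rule I.a_Hcarr)
      then show "f \<ominus> k \<in> carrier KQ"
        using fc by simp
      fix q assume nz: "(f \<ominus> k) q \<noteq> 0" and path: "q \<in> quiver_paths Q"
      obtain u p where q: "q = (u, p)"
        by fastforce
      have u: "u \<in> verts Q"
        using path quiver_paths_start by (simp add: q)
      have fk: "f q \<noteq> k q"
        using nz fc kc by (auto simp: KQ_minus_coeff)
      have other: "p \<notin> S \<or> start p \<noteq> u"
        using fk k_cycle by (auto simp: q)
      then have fq: "f (u, p) \<noteq> 0"
        using fk k_other u by (simp add: q)
      have start: "start p = u" if "p \<noteq> []"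
        using path that by (cases p) (auto simp: q quiver_paths_Cons_iff)
      \<comment> \<open>A complement \<open>r\<close> would be nonempty, as \<open>p\<close> is not
        itself a cycle in \<open>S\<close>, and pairing with \<open>r\<close> would detect the
        nonzero coefficient \<open>f (u, p)\<close>.\<close>
      have dead: "p @ r \<notin> S" if "p \<noteq> []" for r
      proof
        assume S: "p @ r \<in> S"
        then have "r \<noteq> []"
          using other start that by auto
        have rp: "r @ p \<in> S"
          using S by (rule cycle_rotate)
        have "start (p @ r) = u"
          using start that by (simp add: hd_append2)
        then have "form (path_basis (start (r @ p), r) \<otimes> f) = f (u, p)"
          using form_path_basis_mult[OF rp \<open>r \<noteq> []\<close>] by simp
        moreover have "(start (r @ p), r) \<in> quiver_paths Q"
          using cycle(3)[OF rp] quiver_paths_append_iff by blast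
        ultimately show False
          using rad fq by (simp add: path_basis_closed)
      qed
      \<comment> \<open>A full cycle at \<open>u\<close> is complementary to the trivial path and
        detects its coefficient; this is where a vertex without cycles would do harm.\<close>
      have "p \<noteq> []"
      proof
        assume "p = []"
        have "form (path_basis (u, c u) \<otimes> f) = f (u, [])"
          using form_path_basis_mult[of "c u" "[]" f] c[OF u] cycle(1) by simp
        moreover have "(u, c u) \<in> quiver_paths Q"
          using cycle(3) c[OF u] by metis
        ultimately show False
          using rad fq \<open>p = []\<close> by (simp add: path_basis_closed)
      qed
      then show "path_basis q \<in> relation_ideal"
        unfolding q using path dead by (intro dead_path_in_defining_ideal) (auto simp: q)
    qed
    moreover have "f = (f \<ominus> k) \<oplus> k"
      using fc I.a_Hcarr[OF kI] by (simp add: fun_eq_iff KQ_coeff KQ_minus_coeff)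
    ultimately show "f \<in> relation_ideal"
      using kI I.a_closed by metis
  qed
qed

end


section \<open>Admissible cuts\<close>

text \<open>\<open>cycle_at_vertex\<close> stands in for indecomposability;
  \<open>not_isolated\<close> derives it.\<close>

locale cut_defining_pair = unit_defining_pair Q KQ S \<mu>
  for Q :: "('v, 'e) pre_digraph"
    and KQ :: "('k::field, 'v \<times> 'e list \<Rightarrow> 'k) module" (structure)
    and S :: "'e list set" and \<mu> :: "'e list \<Rightarrow> nat" +
  fixes D :: "'e set"
  assumes cut: "admissible_cut Q S D"
    and cycle_at_vertex: "v \<in> verts Q \<Longrightarrow> \<exists>C\<in>S. start C = v"
begin

text \<open>The pieces of a simple cycle share no arrow, so its one arrow in \<open>D\<close> lies
  in exactly one of them.\<close>

lemma cut_split: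
  assumes "p @ q \<in> S"
  shows "set p \<inter> D = {} \<longleftrightarrow> set q \<inter> D \<noteq> {}"
proof -
  have "\<exists>!a. a \<in> D \<and> a \<in> set (p @ q)"
    using cut assms unfolding admissible_cut_def by blast
  moreover have "set p \<inter> set q = {}"
    using cycle(2)[OF assms] by simp
  ultimately show ?thesis
    by auto
qed

section \<open>Projection to degree zero\<close>

definition zero_part :: "('v \<times> 'e list \<Rightarrow> 'k) \<Rightarrow> 'v \<times> 'e list \<Rightarrow> 'k" where
  "zero_part f = (\<lambda>(u, p). if set p \<inter> D = {} then f (u, p) else 0)"

lemma zero_part_coeff: "zero_part f (u, p) = (if set p \<inter> D = {} then f (u, p) else 0)"
  by (simp add: zero_part_def)

lemma zero_part_closed: "f \<in> carrier KQ \<Longrightarrow> zero_part f \<in> carrier KQ"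
  by (auto simp: KQ_carrier_iff zero_part_def elim!: rev_finite_subset split: if_splits)

lemma zero_part_linear:
  "zero_part \<zero> = \<zero>" "zero_part (f \<oplus> g) = zero_part f \<oplus> zero_part g"
  "zero_part (c \<odot> f) = c \<odot> zero_part f"
  by (auto simp: zero_part_def KQ_coeff fun_eq_iff)

lemma zero_part_minus:
  assumes "f \<in> carrier KQ" "g \<in> carrier KQ"
  shows "zero_part (f \<ominus> g) = zero_part f \<ominus> zero_part g"
  using assms by (simp add: fun_eq_iff KQ_minus_coeff zero_part_closed zero_part_coeff)

lemma zero_part_idem: "zero_part (zero_part f) = zero_part f"
  by (auto simp: zero_part_def)

text \<open>A path avoids \<open>D\<close> exactly when both factors of any of its factorisations
  do.\<close>

lemma zero_part_mult: "zero_part (f \<otimes> g) = zero_part f \<otimes> zero_part g"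
proof (rule ext, clarify)
  fix u p
  have disj: "set p \<inter> D = {} \<longleftrightarrow> set (take i p) \<inter> D = {} \<and> set (drop i p) \<inter> D = {}" for i
  proof -
    have "set p = set (take i p) \<union> set (drop i p)"
      by (metis append_take_drop_id set_append)
    then show ?thesis
      by blast
  qed
  show "zero_part (f \<otimes> g) (u, p) = (zero_part f \<otimes> zero_part g) (u, p)"
  proof (cases "set p \<inter> D = {}")
    case True
    then show ?thesis
      using disj by (simp add: zero_part_coeff KQ_coeff(1))
  next
    case False
    then have "zero_part f (u, take i p) * zero_part g (awlast u (take i p), drop i p) = 0" for i
      using disj[of i] by (auto simp: zero_part_coeff)
    then have "(zero_part f \<otimes> zero_part g) (u, p) = 0"
      unfolding KQ_coeff(1) by (intro sum.neutral) blast
    then show ?thesis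
      using False by (simp add: zero_part_coeff)
  qed
qed

lemma form_zero_part: "form (zero_part f) = 0"
proof -
  have "set C \<inter> D \<noteq> {}" if "C \<in> S" for C
    using cut_split[of "[]" C] that by simp
  then show ?thesis
    by (simp add: form_def zero_part_coeff)
qed

text \<open>In every split of a cycle exactly one piece avoids \<open>D\<close>, so each term of the
  pairing is counted in exactly one summand. The two summands become the two bimodule actions in the
  trivial extension.\<close>

lemma form_mult_split: "form (f \<otimes> g) = form (zero_part f \<otimes> g) + form (f \<otimes> zero_part g)"
  unfolding form_mult sum.distrib[symmetric]
proof (intro sum.cong refl, clarify)
  fix p q assume "(p, q) \<in> cycle_splits"
  then have "set p \<inter> D = {} \<longleftrightarrow> set q \<inter> D \<noteq> {}"
    by (intro cut_split) (simp add: cycle_splits_def)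
  then show "f (start (p @ q), p) * g (start (q @ p), q) =
      zero_part f (start (p @ q), p) * g (start (q @ p), q) +
      f (start (p @ q), p) * zero_part g (start (q @ p), q)"
    by (cases "set p \<inter> D = {}") (simp_all add: zero_part_coeff)
qed

text \<open>The radical is homogeneous: in \<open>form_mult_split\<close> the other summand pairs
  \<open>f\<close> with \<open>zero_part g\<close> and vanishes as well.\<close>

lemma zero_part_form_radical:
  assumes "f \<in> form_radical" shows "zero_part f \<in> form_radical"
proof -
  have f: "f \<in> carrier KQ"
    using assms by (simp add: form_radical_def)
  have "form (zero_part f \<otimes> g) = 0" if g: "g \<in> carrier KQ" for g
  proof -
    have "form (f \<otimes> g) = 0" "form (f \<otimes> zero_part g) = 0"
      using assms g by (auto simp: form_radical_def zero_part_closed)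
    then show ?thesis
      using form_mult_split[of f g] by simp
  qed
  then show ?thesis
    using f by (simp add: form_radical_def zero_part_closed)
qed

section \<open>The ideal of the cut algebra\<close>

definition cut_ideal :: "('v \<times> 'e list \<Rightarrow> 'k) set" where
  "cut_ideal = {f \<in> carrier KQ. zero_part f \<in> form_radical}"

lemma cut_ideal_ideal: "ideal cut_ideal KQ"
proof -
  interpret R: ideal form_radical KQ
    by (rule form_radical_ideal)
  show ?thesis
  proof (rule idealI[OF KQ_ring])
    show "subgroup cut_ideal (add_monoid KQ)"
    proof (rule KQ.add.subgroupI)
      show "cut_ideal \<noteq> {}"
        by (auto simp: cut_ideal_def zero_part_linear intro!: exI[of _ \<zero>])
      show "\<ominus> f \<in> cut_ideal" if "f \<in> cut_ideal" for f
      proof -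
        have "zero_part (\<ominus> f) = \<ominus> zero_part f"
          using that by (auto simp: cut_ideal_def KQ_a_inv zero_part_closed zero_part_def)
        then show ?thesis
          using that by (simp add: cut_ideal_def)
      qed
    qed (auto simp: cut_ideal_def zero_part_linear)
  qed (auto simp: cut_ideal_def zero_part_mult zero_part_closed R.I_l_closed R.I_r_closed)
qed

text \<open>The generators have degree zero part in the radical: by homogeneity for relations, and
  because it is zero for arrows in \<open>D\<close>. Conversely, every path through an arrow of
  \<open>D\<close> factors through that arrow, so modulo \<open>D\<close> an element equals its
  degree zero part.\<close>

lemma generated_cut_ideal: "Idl (relation_ideal \<union> {path_elem Q [a] | a. a \<in> D}) = cut_ideal"
proof
  let ?G = "relation_ideal \<union> {path_elem Q [a] | a. a \<in> D}"
  have D_arcs: "D \<subseteq> arcs Q"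
    using cut by (simp add: admissible_cut_def)
  interpret R: ideal form_radical KQ
    by (rule form_radical_ideal)
  note radical = relation_ideal_eq_form_radical[OF cycle_at_vertex]
  have arrow: "path_elem Q [a] \<in> carrier KQ" if "a \<in> D" for a
    using that D_arcs wellformed
    by (auto simp: path_elem_eq quiver_paths_Cons_iff quiver_paths_Nil_iff
        intro!: path_basis_closed)
  have "?G \<subseteq> cut_ideal"
  proof
    fix f assume "f \<in> ?G"
    then consider "f \<in> form_radical" | a where "f = path_elem Q [a]" "a \<in> D"
      using radical by blast
    then show "f \<in> cut_ideal"
    proof cases
      case 1
      then show ?thesis
        using zero_part_form_radical R.a_Hcarr by (simp add: cut_ideal_def)
    next
      case 2
      then have "zero_part f = \<zero>"
        by (auto simp: zero_part_def path_elem_def KQ_coeff fun_eq_iff)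
      then show ?thesis
        using 2 arrow by (simp add: cut_ideal_def)
    qed
  qed
  then show "Idl ?G \<subseteq> cut_ideal"
    by (rule KQ.genideal_minimal[OF cut_ideal_ideal])
  have G: "?G \<subseteq> carrier KQ"
    using \<open>?G \<subseteq> cut_ideal\<close> by (auto simp: cut_ideal_def)
  have ideal_G: "ideal (Idl ?G) KQ"
    by (rule KQ.genideal_ideal[OF G])
  interpret G: ideal "Idl ?G" KQ
    by (rule ideal_G)
  show "cut_ideal \<subseteq> Idl ?G"
  proof
    fix f assume f: "f \<in> cut_ideal"
    then have fc: "f \<in> carrier KQ" and f0: "zero_part f \<in> relation_ideal"
      by (auto simp: cut_ideal_def radical)
    have "f \<ominus> zero_part f \<in> Idl ?G"
    proof (rule mem_ideal_if_paths_mem[OF _ ideal_G])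
      show "f \<ominus> zero_part f \<in> carrier KQ"
        using fc zero_part_closed by simp
      fix q assume nz: "(f \<ominus> zero_part f) q \<noteq> 0" and path: "q \<in> quiver_paths Q"
      obtain u p where q: "q = (u, p)"
        by fastforce
      have "set p \<inter> D \<noteq> {}"
        using nz fc by (auto simp: q KQ_minus_coeff zero_part_closed zero_part_coeff)
      then obtain a where "a \<in> set p" and a: "a \<in> D"
        by blast
      then obtain r s where p: "p = r @ a # s"
        by (meson split_list)
      have paths: "(u, r) \<in> quiver_paths Q" "(head Q a, s) \<in> quiver_paths Q"
          "awlast u r = tail Q a"
        using path by (auto simp: q p quiver_paths_append_iff quiver_paths_Cons_iff)
      then have "path_basis q =
          path_basis (u, r) \<otimes> path_elem Q [a] \<otimes> path_basis (head Q a, s)"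
        by (simp add: path_elem_eq path_basis_mult q p awlast_append)
      moreover have "path_elem Q [a] \<in> Idl ?G"
        using KQ.genideal_self[OF G] a by blast
      ultimately show "path_basis q \<in> Idl ?G"
        using paths by (simp add: G.I_l_closed G.I_r_closed path_basis_closed)
    qed
    moreover have "zero_part f \<in> Idl ?G"
      using KQ.genideal_self[OF G] f0 by blast
    ultimately have "(f \<ominus> zero_part f) \<oplus> zero_part f \<in> Idl ?G"
      by (rule G.a_closed)
    moreover have "(f \<ominus> zero_part f) \<oplus> zero_part f = f"
      using fc by (simp add: fun_eq_iff KQ_coeff KQ_minus_coeff zero_part_closed)
    ultimately show "f \<in> Idl ?G"
      by simp
  qed
qed

section \<open>The map onto the trivial extension\<close>

abbreviation cut_coset :: "('v \<times> 'e list \<Rightarrow> 'k) \<Rightarrow> ('v \<times> 'e list \<Rightarrow> 'k) set" where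
  "cut_coset x \<equiv> cut_ideal +> x"

abbreviation A :: "('k, ('v \<times> 'e list \<Rightarrow> 'k) set) module" where
  "A \<equiv> quotient_algebra KQ cut_ideal"

lemmas A_simps = quotient_algebra_simps[OF cut_ideal_ideal]

lemma cut_coset_eq_iff:
  assumes "x \<in> carrier KQ" "y \<in> carrier KQ"
  shows "cut_coset x = cut_coset y \<longleftrightarrow> zero_part x \<ominus> zero_part y \<in> form_radical"
proof -
  have "cut_coset x = cut_coset y \<longleftrightarrow> x \<ominus> y \<in> cut_ideal"
    using KQ.quotient_eq_iff_same_a_r_cos[OF cut_ideal_ideal assms] by simp
  then show ?thesis
    using assms by (simp add: cut_ideal_def zero_part_minus)
qed

text \<open>The choice of a representative does not affect the value: elements of one coset have the
  same degree zero part modulo the radical, see \<open>functional_cut_coset\<close>.\<close>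

definition functional ::
  "('v \<times> 'e list \<Rightarrow> 'k) \<Rightarrow> ('v \<times> 'e list \<Rightarrow> 'k) set \<Rightarrow> 'k" where
  "functional f = (\<lambda>X\<in>carrier A. form (f \<otimes> zero_part (SOME y. y \<in> X)))"

lemma functional_cut_coset:
  assumes f: "f \<in> carrier KQ" and y: "y \<in> carrier KQ"
  shows "functional f (cut_coset y) = form (f \<otimes> zero_part y)"
proof -
  interpret I: ideal cut_ideal KQ
    by (rule cut_ideal_ideal)
  define z where "z = (SOME z. z \<in> cut_coset y)"
  have z: "z \<in> cut_coset y"
    unfolding z_def by (rule someI[of _ y]) (use y I.a_rcos_self in blast)
  then have zc: "z \<in> carrier KQ"
    using y I.a_rcosets_carrier KQ.a_rcosetsI I.a_subset by blast
  have "cut_coset z = cut_coset y"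
    using z y I.a_repr_independence' by blast
  then have "zero_part z \<ominus> zero_part y \<in> form_radical"
    using zc y by (simp add: cut_coset_eq_iff)
  \<comment> \<open>\<open>form_radical\<close> concerns products with the radical element on the
    left; \<open>form_commute\<close> turns them round below.\<close>
  then have "form ((zero_part z \<ominus> zero_part y) \<otimes> f) = 0"
    using f by (simp add: form_radical_def)
  then have "form (zero_part z \<otimes> f \<ominus> zero_part y \<otimes> f) = 0"
    using f y zc zero_part_closed by (simp add: a_minus_def KQ.l_distr KQ.l_minus)
  then have "form (zero_part z \<otimes> f) = form (zero_part y \<otimes> f)"
    using f y zc zero_part_closed by (simp add: form_minus)
  then have "form (f \<otimes> zero_part z) = form (f \<otimes> zero_part y)"
    using form_commute by metis
  moreover have "functional f (cut_coset y) = form (f \<otimes> zero_part z)"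
    using y by (simp add: functional_def z_def A_simps)
  ultimately show ?thesis
    by simp
qed

lemma functional_eqI:
  assumes "h \<in> extensional (carrier A)" "h' \<in> extensional (carrier A)"
    and "\<And>y. y \<in> carrier KQ \<Longrightarrow> h (cut_coset y) = h' (cut_coset y)"
  shows "h = h'"
  using assms by (intro extensionalityI[of h "carrier A"]) (auto simp: A_simps)

lemma functional_extensional: "functional f \<in> extensional (carrier A)"
  by (simp add: functional_def)

lemma functional_in_dual_space:
  assumes "f \<in> carrier KQ" shows "functional f \<in> dual_space A"
  using assms functional_extensional[of f]
  by (auto simp: dual_space_def A_simps functional_cut_coset
      KQ_smult_closed zero_part_linear zero_part_closed KQ.r_distr form_linear KQ_smult_mult)

definition to_trivial_extension ::
  "('v \<times> 'e list \<Rightarrow> 'k) \<Rightarrow>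
    ('v \<times> 'e list \<Rightarrow> 'k) set \<times> (('v \<times> 'e list \<Rightarrow> 'k) set \<Rightarrow> 'k)" where
  "to_trivial_extension f = (cut_coset f, functional f)"

text \<open>\<open>form_mult_split\<close> divides the pairing of \<open>f\<close> with
  \<open>g \<otimes> zero_part y\<close> into two terms. By the symmetry of the form the first is
  \<open>functional g\<close> at the class of \<open>y \<otimes> f\<close>; the second is
  \<open>functional f\<close> at the class of \<open>g \<otimes> y\<close>.\<close>

lemma to_trivial_extension_mult:
  assumes f: "f \<in> carrier KQ" and g: "g \<in> carrier KQ"
  shows "to_trivial_extension (f \<otimes> g) =
    to_trivial_extension f \<otimes>\<^bsub>trivial_extension A\<^esub> to_trivial_extension g"
proof -
  have "functional (f \<otimes> g) = dual_add A (dual_act A (cut_coset f) (functional g) \<one>\<^bsub>A\<^esub>)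
      (dual_act A \<one>\<^bsub>A\<^esub> (functional f) (cut_coset g))"
  proof (rule functional_eqI)
    fix y assume y: "y \<in> carrier KQ"
    have "form ((f \<otimes> g) \<otimes> zero_part y) =
        form (zero_part f \<otimes> (g \<otimes> zero_part y)) + form (f \<otimes> (zero_part g \<otimes> zero_part y))"
      using form_mult_split[of f "g \<otimes> zero_part y"]
      by (simp add: KQ_m_assoc zero_part_mult zero_part_idem)
    also have "form (zero_part f \<otimes> (g \<otimes> zero_part y)) =
        form (g \<otimes> (zero_part y \<otimes> zero_part f))"
      using form_commute[of "zero_part f" "g \<otimes> zero_part y"] by (simp add: KQ_m_assoc)
    finally show "functional (f \<otimes> g) (cut_coset y) =
        dual_add A (dual_act A (cut_coset f) (functional g) \<one>\<^bsub>A\<^esub>)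
          (dual_act A \<one>\<^bsub>A\<^esub> (functional f) (cut_coset g)) (cut_coset y)"
      using f g y by (simp add: dual_add_def dual_act_def A_simps functional_cut_coset
          zero_part_mult KQ_l_one KQ_r_one)
  qed (simp_all add: functional_extensional dual_add_def)
  then show ?thesis
    using f g by (simp add: to_trivial_extension_def trivial_extension_def A_simps)
qed

lemma to_trivial_extension_add:
  assumes "f \<in> carrier KQ" and "g \<in> carrier KQ"
  shows "to_trivial_extension (f \<oplus> g) =
    to_trivial_extension f \<oplus>\<^bsub>trivial_extension A\<^esub> to_trivial_extension g"
proof -
  have "functional (f \<oplus> g) = dual_add A (functional f) (functional g)"
    by (rule functional_eqI) (use assms functional_extensional in \<open>simp_all add: dual_add_def
        functional_cut_coset A_simps zero_part_closed KQ.l_distr form_linear\<close>)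
  then show ?thesis
    using assms by (simp add: to_trivial_extension_def trivial_extension_def A_simps)
qed

lemma to_trivial_extension_smult:
  assumes "f \<in> carrier KQ"
  shows "to_trivial_extension (c \<odot> f) = c \<odot>\<^bsub>trivial_extension A\<^esub> to_trivial_extension f"
proof -
  have "functional (c \<odot> f) = (\<lambda>x\<in>carrier A. c * functional f x)"
    by (rule functional_eqI) (use assms functional_extensional in \<open>simp_all add:
        functional_cut_coset A_simps KQ_smult_closed KQ_smult_mult form_linear\<close>)
  then show ?thesis
    using assms by (simp add: to_trivial_extension_def trivial_extension_def A_simps)
qed

text \<open>The form vanishes in degree zero, since every cycle contains an arrow of
  \<open>D\<close>.\<close>

lemma to_trivial_extension_one: "to_trivial_extension \<one> = \<one>\<^bsub>trivial_extension A\<^esub>"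
proof -
  have "functional \<one> = (\<lambda>x\<in>carrier A. 0)"
    by (rule functional_eqI) (use functional_extensional in \<open>simp_all add: functional_cut_coset
        A_simps zero_part_closed KQ_l_one form_zero_part\<close>)
  then show ?thesis
    by (simp add: to_trivial_extension_def trivial_extension_def A_simps)
qed

text \<open>Equal cosets control the pairings of the degree zero part of the difference, equal
  functionals its pairings with elements of degree zero. By \<open>form_mult_split\<close> these
  make up all pairings.\<close>

lemma to_trivial_extension_eq_iff:
  assumes f: "f \<in> carrier KQ" and g: "g \<in> carrier KQ"
  shows "to_trivial_extension f = to_trivial_extension g \<longleftrightarrow> f \<ominus> g \<in> form_radical"
proof
  let ?h = "f \<ominus> g"
  have h: "?h \<in> carrier KQ" and h0: "zero_part ?h = zero_part f \<ominus> zero_part g"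
    using f g by (simp_all add: zero_part_minus)
  have form_h: "form (?h \<otimes> y) = form (f \<otimes> y) - form (g \<otimes> y)" if "y \<in> carrier KQ" for y
  proof -
    have "?h \<otimes> y = f \<otimes> y \<ominus> g \<otimes> y"
      using f g that by (simp add: a_minus_def KQ.l_distr KQ.l_minus)
    then show ?thesis
      using f g that by (simp add: form_minus)
  qed
  show "?h \<in> form_radical" if eq: "to_trivial_extension f = to_trivial_extension g"
  proof -
    have "form (?h \<otimes> y) = 0" if y: "y \<in> carrier KQ" for y
    proof -
      have "zero_part ?h \<in> form_radical"
        using eq f g by (simp add: to_trivial_extension_def cut_coset_eq_iff h0)
      then have "form (zero_part ?h \<otimes> y) = 0"
        using y by (simp add: form_radical_def)
      moreover have "form (f \<otimes> zero_part y) = form (g \<otimes> zero_part y)"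
        using eq f g y functional_cut_coset
        unfolding to_trivial_extension_def by (metis prod.inject)
      then have "form (?h \<otimes> zero_part y) = 0"
        using y by (simp add: form_h zero_part_closed)
      ultimately show ?thesis
        using form_mult_split[of ?h y] by simp
    qed
    then show ?thesis
      using h by (simp add: form_radical_def)
  qed
  show "to_trivial_extension f = to_trivial_extension g" if rad: "?h \<in> form_radical"
  proof -
    have "cut_coset f = cut_coset g"
      using zero_part_form_radical[OF rad] f g by (simp add: cut_coset_eq_iff h0)
    moreover have "functional f = functional g"
    proof (rule functional_eqI)
      fix y assume y: "y \<in> carrier KQ"
      then have "form (?h \<otimes> zero_part y) = 0"
        using rad by (simp add: form_radical_def zero_part_closed)
      then show "functional f (cut_coset y) = functional g (cut_coset y)"
        using f g y by (simp add: functional_cut_coset form_h zero_part_closed)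
    qed (simp_all add: functional_extensional)
    ultimately show ?thesis
      by (simp add: to_trivial_extension_def)
  qed
qed

text \<open>
  A functional is determined by its values on the surviving paths avoiding \<open>D\<close>, and the
  complement of such a path in a cycle is dual to it with respect to the form.
\<close>

lemma dual_space_functional:
  assumes \<xi>: "\<xi> \<in> dual_space A"
  obtains k where "k \<in> carrier KQ" "zero_part k = \<zero>"
    "\<And>y. y \<in> carrier KQ \<Longrightarrow> form (k \<otimes> zero_part y) = \<xi> (cut_coset y)"
proof -
  interpret R: ideal form_radical KQ
    by (rule form_radical_ideal)
  have \<xi>_add: "\<xi> (cut_coset (x \<oplus> y)) = \<xi> (cut_coset x) + \<xi> (cut_coset y)"
    if "x \<in> carrier KQ" "y \<in> carrier KQ" for x y
  proof -
    have "\<xi> (cut_coset x \<oplus>\<^bsub>A\<^esub> cut_coset y) = \<xi> (cut_coset x) + \<xi> (cut_coset y)"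
      using \<xi> that unfolding dual_space_def A_simps(1) by blast
    then show ?thesis
      using that by (simp add: A_simps)
  qed
  have \<xi>_smult: "\<xi> (cut_coset (c \<odot> x)) = c * \<xi> (cut_coset x)" if "x \<in> carrier KQ" for c x
  proof -
    have "\<xi> (c \<odot>\<^bsub>A\<^esub> cut_coset x) = c * \<xi> (cut_coset x)"
      using \<xi> that unfolding dual_space_def A_simps(1) by blast
    then show ?thesis
      using that by (simp add: A_simps)
  qed
  have \<xi>_zero: "\<xi> (cut_coset x) = 0" if x: "x \<in> carrier KQ" "zero_part x \<in> form_radical" for x
  proof -
    have "cut_coset x = cut_coset (0 \<odot> x)"
      using x by (simp add: cut_coset_eq_iff KQ_smult_closed zero_part_linear a_minus_def
          R.a_closed R.a_inv_closed ideal_smult_closed[OF form_radical_ideal])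
    then show ?thesis
      using \<xi>_smult[OF x(1), of 0] by simp
  qed
  \<comment> \<open>Using \<open>start (p @ r)\<close> includes the case \<open>p = []\<close>: any
    cycle at \<open>u\<close> is a complement of the trivial path there.\<close>
  define B where
    "B = {(u, p). set p \<inter> D = {} \<and> (\<exists>r. p @ r \<in> S \<and> start (p @ r) = u)}"
  have "B \<subseteq> (\<lambda>(p, r). (start (p @ r), p)) ` cycle_splits"
    by (auto simp: B_def cycle_splits_def image_iff)
  then have finite_B: "finite B"
    using finite_cycle_splits by (meson finite_imageI finite_subset)
  define c where "c q = (SOME r. snd q @ r \<in> S \<and> start (snd q @ r) = fst q)" for q
  have c: "p @ c (u, p) \<in> S" "start (p @ c (u, p)) = u" "set (c (u, p)) \<inter> D \<noteq> {}"
    if q: "(u, p) \<in> B" for u p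
  proof -
    have "\<exists>r. p @ r \<in> S \<and> start (p @ r) = u"
      using q by (simp add: B_def)
    then show *: "p @ c (u, p) \<in> S" "start (p @ c (u, p)) = u"
      unfolding c_def fst_conv snd_conv by (metis (mono_tags, lifting) someI_ex)+
    show "set (c (u, p)) \<inter> D \<noteq> {}"
      using cut_split[OF *(1)] q by (simp add: B_def)
  qed
  define b where "b q = path_basis (start (c q @ snd q), c q)" for q
  have b_closed: "b q \<in> carrier KQ" if "q \<in> B" for q
  proof (cases q)
    case (Pair u p)
    then have "c q @ p \<in> S"
      using c(1) that cycle_rotate by blast
    then show ?thesis
      using cycle(3) quiver_paths_append_iff unfolding b_def
      by (intro path_basis_closed) (auto simp: Pair)
  qed
  \<comment> \<open>\<open>c q\<close> contains an arrow of \<open>D\<close>, so it is nonempty and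
    reads off the coefficient at \<open>q\<close> alone, even if \<open>q\<close> is a trivial
    path.\<close>
  have b_dual: "form (b q \<otimes> y) = y q" if "q \<in> B" for q y
  proof (cases q)
    case (Pair u p)
    then have *: "c q @ p \<in> S" "c q \<noteq> []" "start (p @ c q) = u"
      using c[of u p] that cycle_rotate by auto
    show ?thesis
      using form_path_basis_mult[OF *(1,2), of y] *(3) by (simp add: b_def Pair)
  qed
  define k where "k = (\<lambda>z. \<Sum>q\<in>B. (\<xi> (cut_coset (path_basis q)) \<odot> b q) z)"
  have k_closed: "k \<in> carrier KQ"
    unfolding k_def by (rule ideal_sum_closed[OF KQ.oneideal finite_B])
      (simp add: b_closed KQ_smult_closed)
  have form_k: "form (k \<otimes> y) = (\<Sum>q\<in>B. \<xi> (cut_coset (path_basis q)) * y q)" for y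
  proof -
    have "form (k \<otimes> y) = (\<Sum>q\<in>B. form ((\<xi> (cut_coset (path_basis q)) \<odot> b q) \<otimes> y))"
      unfolding form_mult k_def
      by (simp add: sum_distrib_right case_prod_unfold) (rule sum.swap)
    also have "\<dots> = (\<Sum>q\<in>B. \<xi> (cut_coset (path_basis q)) * y q)"
      by (intro sum.cong) (simp_all add: KQ_smult_mult form_linear b_dual)
    finally show ?thesis .
  qed
  have "zero_part k = \<zero>"
  proof (rule ext, clarify)
    fix u p
    have "b q (u, p) = 0" if "q \<in> B" "set p \<inter> D = {}" for q
      using c(3)[of "fst q" "snd q"] that by (auto simp: b_def path_basis_def)
    then show "zero_part k (u, p) = \<zero> (u, p)"
      by (simp add: zero_part_coeff k_def KQ_coeff)
  qed
  moreover have "form (k \<otimes> zero_part y) = \<xi> (cut_coset y)" if "y \<in> carrier KQ" for y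
    using that
  proof (induction rule: KQ_induct)
    case zero
    then show ?case
      using \<xi>_zero[of \<zero>] k_closed by (simp add: zero_part_linear form_linear R.zero_closed)
  next
    case (basis q)
    obtain u p where q: "q = (u, p)"
      by fastforce
    have e: "path_basis q \<in> carrier KQ"
      using basis(2) by (rule path_basis_closed)
    have "form (k \<otimes> zero_part (path_basis q)) = \<xi> (cut_coset (path_basis q))"
    proof (cases "q \<in> B")
      case True
      have "zero_part (path_basis q) = path_basis q"
        using True by (auto simp: q B_def zero_part_def path_basis_def fun_eq_iff)
      then show ?thesis
        using True finite_B by (simp add: form_k path_basis_def if_distrib cong: if_cong)
    next
      \<comment> \<open>A path outside \<open>B\<close> meets \<open>D\<close> or extends to no
        cycle. In both cases it is zero in \<open>A\<close>, so \<open>\<xi>\<close> vanishes on it,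
        and \<open>form_k\<close> has no term for it.\<close>
      case False
      have "zero_part (path_basis q) q' = 0" if "q' \<in> B" for q'
        using False that by (cases q') (auto simp: zero_part_coeff path_basis_def)
      then have "form (k \<otimes> zero_part (path_basis q)) = 0"
        by (simp add: form_k)
      moreover have "zero_part (path_basis q) \<in> form_radical"
      proof (cases "set p \<inter> D = {}")
        case True
        have "u \<in> verts Q"
          using basis(2) quiver_paths_start by (simp add: q)
        then have "p \<noteq> []"
          using False True cycle_at_vertex[of u] by (auto simp: q B_def)
        then have "start (p @ r) = u" for r
          using basis(2) by (cases p) (auto simp: q quiver_paths_Cons_iff)
        then have "p @ r \<notin> S" for r
          using False True by (auto simp: q B_def)
        then have "path_basis q \<in> form_radical"
          unfolding q using basis(2) by (intro dead_path_in_form_radical) (simp_all add: q)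
        then show ?thesis
          by (rule zero_part_form_radical)
      next
        case False
        then have "zero_part (path_basis q) = \<zero>"
          by (auto simp: q zero_part_def path_basis_def KQ_coeff fun_eq_iff)
        then show ?thesis
          by (simp add: R.zero_closed)
      qed
      ultimately show ?thesis
        using \<xi>_zero[OF e] by simp
    qed
    then show ?case
      using e by (simp add: zero_part_linear KQ_smult_mult form_linear \<xi>_smult)
  next
    case (add g h)
    then show ?case
      using k_closed
      by (simp add: zero_part_linear zero_part_closed KQ.r_distr form_linear \<xi>_add)
  qed
  ultimately show thesis
    using that k_closed by blast
qed

text \<open>A pair \<open>(cut_coset a, \<xi>)\<close> comes from
  \<open>zero_part a \<oplus> k\<close>, where \<open>k\<close> represents \<open>\<xi>\<close> and
  has no degree zero part. The summands do not interfere: \<open>k\<close> leaves the coset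
  unchanged, and \<open>zero_part a\<close> induces the zero functional.\<close>

lemma to_trivial_extension_onto:
  "to_trivial_extension ` carrier KQ = carrier (trivial_extension A)"
proof
  show "to_trivial_extension ` carrier KQ \<subseteq> carrier (trivial_extension A)"
    by (auto simp: to_trivial_extension_def trivial_extension_def A_simps
        functional_in_dual_space)
  show "carrier (trivial_extension A) \<subseteq> to_trivial_extension ` carrier KQ"
  proof
    fix t assume "t \<in> carrier (trivial_extension A)"
    then obtain a \<xi> where t: "t = (cut_coset a, \<xi>)" and a: "a \<in> carrier KQ"
        and \<xi>: "\<xi> \<in> dual_space A"
      by (auto simp: trivial_extension_def A_simps)
    obtain k where k: "k \<in> carrier KQ" "zero_part k = \<zero>"
        "\<And>y. y \<in> carrier KQ \<Longrightarrow> form (k \<otimes> zero_part y) = \<xi> (cut_coset y)"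
      using dual_space_functional[OF \<xi>] by blast
    define f where "f = zero_part a \<oplus> k"
    have f: "f \<in> carrier KQ"
      using a k by (simp add: f_def zero_part_closed)
    have "zero_part f = zero_part a"
      using a k by (simp add: f_def zero_part_linear zero_part_idem zero_part_closed)
    then have "cut_coset f = cut_coset a"
      using a f cut_coset_eq_iff by metis
    moreover have "functional f = \<xi>"
    proof (rule functional_eqI)
      fix y assume y: "y \<in> carrier KQ"
      have "form (zero_part a \<otimes> zero_part y) = 0"
        using form_zero_part[of "a \<otimes> y"] by (simp add: zero_part_mult)
      then show "functional f (cut_coset y) = \<xi> (cut_coset y)"
        using a f k y
        by (simp add: functional_cut_coset) (simp add: f_def KQ.l_distr zero_part_closed form_linear)
    qed (use \<xi> in \<open>simp_all add: functional_extensional dual_space_def\<close>)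
    ultimately show "t \<in> to_trivial_extension ` carrier KQ"
      using f t by (auto simp: to_trivial_extension_def)
  qed
qed

lemma trivial_extension_isomorphic:
  "algebra_isomorphic (trivial_extension A) (quotient_algebra KQ relation_ideal)"
proof -
  have eq: "relation_ideal = form_radical"
    using cycle_at_vertex by (rule relation_ideal_eq_form_radical)
  show ?thesis
    unfolding eq
    using form_radical_ideal to_trivial_extension_onto to_trivial_extension_eq_iff
      to_trivial_extension_mult to_trivial_extension_add to_trivial_extension_one
      to_trivial_extension_smult
    by (rule algebra_isomorphic_quotientI)
qed

end

theorem theorem5p4:
  fixes Q :: "('v, 'e) pre_digraph"
    and S :: "'e list set" and \<mu> :: "'e list \<Rightarrow> nat" and D :: "'e set"
    and \<Lambda> A :: "('k::field, ('v \<times> 'e list \<Rightarrow> 'k) set) module"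
  assumes "defining_pair Q S \<mu>"
    and "S \<noteq> {}"
    and "\<forall>C\<in>S. \<mu> C = 1"
    and "\<Lambda> = defined_algebra Q S"
    and "indecomposable_algebra \<Lambda>"
    and "admissible_cut Q S D"
    and "A = cut_algebra Q S D"
  shows "algebra_isomorphic (trivial_extension A) \<Lambda>"
proof -
  define KQ :: "('k, 'v \<times> 'e list \<Rightarrow> 'k) module" where "KQ = path_algebra Q"
  interpret defining_pair Q S \<mu>
    by fact
  interpret unit_defining_pair Q KQ S \<mu>
    by unfold_locales (use assms in \<open>simp_all add: KQ_def\<close>)
  have \<Lambda>: "\<Lambda> = quotient_algebra KQ relation_ideal"
    using assms(4) by (simp add: defined_algebra_def KQ_def)
  \<comment> \<open>Indecomposability enters here: through \<open>not_isolated\<close> it provides a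
    cycle in \<open>S\<close> at every vertex.\<close>
  interpret cut_defining_pair Q KQ S \<mu> D
    using assms(5,6) not_isolated unfolding \<Lambda> by unfold_locales
  have "A = quotient_algebra KQ cut_ideal"
    using assms(7) generated_cut_ideal by (simp add: cut_algebra_def KQ_def)
  then show ?thesis
    using trivial_extension_isomorphic \<Lambda> by simp
qed

end
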